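(* Assume that the $abc$-conjecture is true. Let $E$ be an elliptic curve over $\mathbb{Q}$ with short Weierstrass equation $y^2=f(x)$, where $f(x)\in\mathbb{Z}[x]$ is reducible over $\mathbb{Q}$. Then, as $D\to\infty$, $$|T_E(D)|\le D^{2/3+o(1)}.$$
   Context: The $abc$-conjecture: for every $\varepsilon>0$ there is a constant $C_\varepsilon$ such that for all non-zero coprime integers $a,b,c$ with $a+b+c=0$ one has $\max(|a|,|b|,|c|)\le C_\varepsilon\,\mathrm{rad}(abc)^{1+\varepsilon}$, where $\mathrm{rad}(n)$ is the product of the distinct primes dividing $n$. Here $f$ is a separable cubic polynomial with integer coefficients (the paper does not require it to be monic or to have vanishing quadratic coefficient). For a squarefree integer $d$, $E_d$ denotes the $d$-th quadratic twist of $E$ with the integral model $dy^2=f(x)$. An integral point of $E_d$ is nontrivial if it is not a two-torsion point, i.e. it is a pair $(x,y)\in\mathbb{Z}^2$ with $dy^2=f(x)$ and $y\ne0$. Define $$T_E(D)=\{d\in\mathbb{Z}: |d|\le D,\ d\text{ is squarefree and }E_d\text{ has a nontrivial integral point}\}.$$ The $o(1)$ may depend on $E$ (and $f$) and tends to $0$ as $D\to\infty$. *)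

theory Defs
  imports Complex_Main "HOL-Computational_Algebra.Computational_Algebra"
begin

(* prime_factors on int consists of positive primes, so rad n does not depend on the sign of n. *)
definition rad :: "int \<Rightarrow> int" where
  "rad n = \<Prod>(prime_factors n)"

definition abc_conjecture :: bool where
  "abc_conjecture \<longleftrightarrow>
     (\<forall>\<epsilon>::real. \<epsilon> > 0 \<longrightarrow>
       (\<exists>C::real. \<forall>a b c :: int.
          a \<noteq> 0 \<and> b \<noteq> 0 \<and> c \<noteq> 0 \<and> gcd a (gcd b c) = 1 \<and> a + b + c = 0 \<longrightarrow>
          real_of_int (max \<bar>a\<bar> (max \<bar>b\<bar> \<bar>c\<bar>)) \<le> C * real_of_int (rad (a * b * c)) powr (1 + \<epsilon>)))"

definition rat_poly_of :: "int poly \<Rightarrow> rat poly" where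
  "rat_poly_of f = map_poly of_int f"

(* y^2 = f(x) is a short Weierstrass equation of an elliptic curve over the rationals:
   f is a separable cubic, not necessarily monic, with arbitrary quadratic coefficient. *)
definition elliptic_cubic :: "int poly \<Rightarrow> bool" where
  "elliptic_cubic f \<longleftrightarrow> degree f = 3 \<and> coprime (rat_poly_of f) (pderiv (rat_poly_of f))"

definition reducible_over_rat :: "int poly \<Rightarrow> bool" where
  "reducible_over_rat f \<longleftrightarrow> \<not> irreducible (rat_poly_of f)"

(* Integral points of d * y^2 = f(x) that are not two-torsion, i.e. have y nonzero. *)
definition nontrivial_integral_points :: "int poly \<Rightarrow> int \<Rightarrow> (int \<times> int) set" where
  "nontrivial_integral_points f d = {(x, y). d * y\<^sup>2 = poly f x \<and> y \<noteq> 0}"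

definition T :: "int poly \<Rightarrow> real \<Rightarrow> int set" where
  "T f D = {d. real_of_int \<bar>d\<bar> \<le> D \<and> squarefree d \<and> nontrivial_integral_points f d \<noteq> {}}"

(* Hence card (T f D) is the genuine number of such twists. *)
lemma finite_T: "finite (T f D)"
proof (rule finite_subset)
  show "T f D \<subseteq> {- \<lfloor>D\<rfloor>..\<lfloor>D\<rfloor>}"
    by (auto simp: T_def le_floor_iff abs_le_iff minus_le_iff)
qed simp

end

theory Submission
  imports Defs
begin

text \<open>
  A rational root of $f$ turns $d y^2 = f(x)$, after a linear change of variable, into
  $d Y^2 = X H(X)$ with an integral quadratic $H = A X^2 + B X + C$ such that $A$, $C$ and the discriminant
  of $H$ are nonzero (\<open>cubic_normal_form\<close>). Two facts then control the number of twists.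

  The abc conjecture bounds the height: $|X|$ is at most $|d|^{1 + o(1)}$ up to a constant
  (\<open>abc_height_bound\<close>). For this one needs that the radical of
  $X H(X)$ is almost as large as $|X|^2$. The conjecture
  yields it once it is applied to an identity between three polynomials in $X$ of degree at most $M$ whose
  distinct zeros, apart from those of $X H(X)$, number at most $M - 2$. Such an identity comes from a Belyi
  map. The quadratic map $X \<mapsto> 4 A H(X)$ moves the roots of $X H(X)$, its branch points and
  $\<infinity>$ to at most four rational points, and a function $w^i (w - s)^j$ with suitable exponents
  moves these to $0$, $1$ and $\<infinity>$ (\<open>belyi_map_four_points\<close>, \<open>radical_exponent\<close>).

  The factorization gives the saving in the count. Write $X = e_1 y_1^2$ and $H(X) = e_2 y_2^2$ with
  squarefree $e_1$, $e_2$. Their common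
  divisors divide $C$, so $|e_1 e_2| \<le> C^2 |d|$. If $|e_1| \<le> D^{1/3}$, then $X$ is one of the
  at most $D^{1/2 + 1/6 + o(1)}$ integers of size $D^{1 + o(1)}$ with such a small squarefree part
  (\<open>card_small_cofactor_of_square_le\<close>). Otherwise $|e_2| \<le> C^2 D^{2/3}$, and for each $e_2$ the
  equation $H(X) = e_2 y_2^2$ is a Pell equation whose right-hand side does not depend on $e_2$; it
  has only $O(\log D)$ solutions of the relevant size (\<open>pell_orbit_gap\<close>,
  \<open>card_small_cofactor_quadratic_le\<close>). As $X$ determines $d$, both cases together give the
  exponent $2/3$.
\<close>

section \<open>The radical and the abc conjecture\<close>

lemma rad_pos: "rad n > 0"
  unfolding rad_def by (intro prod_pos) (auto dest: in_prime_factors_imp_prime prime_gt_0_int)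

lemma rad_dvd:
  assumes "n \<noteq> 0"
  shows "rad n dvd n"
proof -
  have "(\<Prod>p\<in>prime_factors n. p) dvd (\<Prod>p\<in>prime_factors n. p ^ multiplicity p n)"
    by (intro prod_dvd_prod dvd_power) (auto simp: prime_factors_multiplicity)
  also have "\<dots> = normalize n" using assms by (rule prod_prime_factors)
  finally show ?thesis by (simp add: rad_def)
qed

lemma rad_le_abs: "n \<noteq> 0 \<Longrightarrow> rad n \<le> \<bar>n\<bar>"
  using rad_dvd[of n] dvd_imp_le_int[of n "rad n"] rad_pos[of n] by simp

lemma rad_mono:
  assumes "n \<noteq> 0" "\<And>p. prime p \<Longrightarrow> p dvd m \<Longrightarrow> p dvd n"
  shows "rad m \<le> rad n"
proof (cases "m = 0")
  case True
  then show ?thesis using rad_pos[of n] by (simp add: rad_def)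
next
  case False
  have "prime_factors m \<subseteq> prime_factors n"
    using assms by (auto simp: in_prime_factors_iff)
  then show ?thesis unfolding rad_def
    by (intro prod_mono2) (auto dest!: in_prime_factors_imp_prime prime_gt_0_int)
qed

lemma rad_mult_le:
  assumes "m \<noteq> 0" "n \<noteq> 0"
  shows "rad (m * n) \<le> rad m * rad n"
proof -
  have "rad (m * n) = \<Prod>(prime_factors m \<union> (prime_factors n - prime_factors m))"
    using assms by (simp add: rad_def prime_factors_product Un_Diff_cancel)
  also have "\<dots> = rad m * \<Prod>(prime_factors n - prime_factors m)"
    unfolding rad_def by (rule prod.union_disjoint) auto
  also have "\<Prod>(prime_factors n - prime_factors m) \<le> rad n"
    unfolding rad_def
    by (intro prod_mono2) (auto dest!: in_prime_factors_imp_prime prime_gt_0_int)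
  finally show ?thesis using rad_pos[of m] by simp
qed

text \<open>A square contributes only its root to the radical. This is where the shape $d y^2$ of the values
  of the cubic enters the height bound: the radical is at most the square root of
  $|d| \<cdot> |d y^2|$.\<close>

lemma rad_mult_square_le:
  assumes "d \<noteq> 0" "y \<noteq> 0"
  shows "rad (d * y\<^sup>2) \<le> \<bar>d\<bar> * \<bar>y\<bar>"
proof -
  have "rad (d * y\<^sup>2) \<le> rad (d * y)"
    using assms by (intro rad_mono) (auto simp: prime_dvd_mult_iff prime_dvd_power_iff)
  also have "\<dots> \<le> \<bar>d * y\<bar>" using assms by (intro rad_le_abs) auto
  finally show ?thesis by (simp add: abs_mult)
qed

text \<open>The terms of the polynomial identities used later are coprime only up to a bounded factor.
  Dividing that factor out can only shrink the radical, so it costs no more than itself in the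
  conclusion of the conjecture.\<close>

lemma abc_with_common_factor:
  assumes "abc_conjecture" "\<epsilon> > 0"
  obtains \<kappa> :: real where "\<kappa> \<ge> 1" and
    "\<And>p q r g :: int. \<lbrakk>p \<noteq> 0; q \<noteq> 0; r \<noteq> 0; p + q + r = 0; g \<noteq> 0; gcd p q dvd g\<rbrakk> \<Longrightarrow>
       real_of_int \<bar>p\<bar> \<le> \<kappa> * real_of_int \<bar>g\<bar> * real_of_int (rad (p * q * r)) powr (1 + \<epsilon>)"
proof -
  obtain C where C: "\<And>a b c :: int. a \<noteq> 0 \<and> b \<noteq> 0 \<and> c \<noteq> 0 \<and> gcd a (gcd b c) = 1 \<and> a + b + c = 0 \<Longrightarrow>
          real_of_int (max \<bar>a\<bar> (max \<bar>b\<bar> \<bar>c\<bar>)) \<le> C * real_of_int (rad (a * b * c)) powr (1 + \<epsilon>)"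
    using assms unfolding abc_conjecture_def by blast
  show ?thesis
  proof (rule that[of "max C 1"])
    fix p q r g :: int
    assume nz: "p \<noteq> 0" "q \<noteq> 0" "r \<noteq> 0" and s: "p + q + r = 0" and g: "g \<noteq> 0" "gcd p q dvd g"
    define h where "h = gcd p q"
    have h0: "h > 0" using nz by (simp add: h_def)
    have "h dvd p" "h dvd q" by (simp_all add: h_def)
    then obtain a b where ab: "p = h * a" "q = h * b" by (auto elim!: dvdE)
    have cop: "gcd a b = 1"
    proof -
      have "gcd (h * a) (h * b) = h" using h_def ab by metis
      hence "h * gcd a b = h" using h0 by (simp add: gcd_mult_distrib_int[symmetric])
      thus ?thesis using h0 by simp
    qed
    define c where "c = - a - b"
    have r: "r = h * c" using s ab by (simp add: c_def algebra_simps)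
    have nz': "a \<noteq> 0" "b \<noteq> 0" "c \<noteq> 0" using nz ab r by auto
    have "gcd a (gcd b c) = 1" by (simp add: gcd.assoc[symmetric] cop)
    hence *: "real_of_int (max \<bar>a\<bar> (max \<bar>b\<bar> \<bar>c\<bar>)) \<le> C * real_of_int (rad (a * b * c)) powr (1 + \<epsilon>)"
      using nz' by (intro C) (auto simp: c_def)
    have le: "rad (a * b * c) \<le> rad (p * q * r)"
      using nz unfolding ab r by (intro rad_mono) (auto simp: prime_dvd_mult_iff)
    have "real_of_int \<bar>a\<bar> \<le> C * real_of_int (rad (a * b * c)) powr (1 + \<epsilon>)"
      using * by simp
    also have "\<dots> \<le> max C 1 * real_of_int (rad (p * q * r)) powr (1 + \<epsilon>)"
      using le rad_pos[of "a * b * c"] assms(2)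
      by (intro mult_mono powr_mono2) auto
    finally have a: "real_of_int \<bar>a\<bar> \<le> max C 1 * real_of_int (rad (p * q * r)) powr (1 + \<epsilon>)" .
    have "h \<le> \<bar>g\<bar>" using g dvd_imp_le_int[of g h] h0 by (simp add: h_def)
    hence "real_of_int \<bar>p\<bar> \<le> real_of_int \<bar>g\<bar> * real_of_int \<bar>a\<bar>"
      using h0 unfolding ab abs_mult of_int_mult by (intro mult_right_mono) auto
    also have "\<dots> \<le> real_of_int \<bar>g\<bar> * (max C 1 * real_of_int (rad (p * q * r)) powr (1 + \<epsilon>))"
      using a by (intro mult_left_mono) auto
    finally show "real_of_int \<bar>p\<bar> \<le> max C 1 * real_of_int \<bar>g\<bar> * real_of_int (rad (p * q * r)) powr (1 + \<epsilon>)"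
      by (simp add: mult_ac)
  qed simp
qed

section \<open>Squarefree parts\<close>

text \<open>The parities of the multiplicities of $a x^2$ determine the primes in a squarefree $a$, and its
  sign is that of $a x^2$. Consequently a twist $d$ can be recovered from the abscissa of any of
  its nontrivial integral points.\<close>

lemma squarefree_unique:
  fixes a b x y :: int
  assumes "squarefree a" "squarefree b" "a * x\<^sup>2 = b * y\<^sup>2" "x \<noteq> 0" "y \<noteq> 0"
  shows "a = b"
proof -
  have nz: "a \<noteq> 0" "b \<noteq> 0" using assms by auto
  have le: "multiplicity p n \<le> 1" if "prime p" "squarefree n" for p n :: int
  proof (rule ccontr)
    assume "\<not> multiplicity p n \<le> 1"
    hence "p\<^sup>2 dvd n" by (intro multiplicity_dvd') auto
    with that show False by (meson not_prime_unit squarefreeD)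
  qed
  have "multiplicity p a = multiplicity p b" if p: "prime p" for p
  proof -
    have "multiplicity p a + 2 * multiplicity p x = multiplicity p b + 2 * multiplicity p y"
      using arg_cong[OF assms(3), of "multiplicity p"] assms(4,5) nz prime_imp_prime_elem[OF p]
      by (simp add: prime_elem_multiplicity_mult_distrib prime_elem_multiplicity_power_distrib)
    with le[OF p assms(1)] le[OF p assms(2)] show ?thesis by presburger
  qed
  hence "normalize a = normalize b" using nz by (intro multiplicity_eq_imp_eq) auto
  hence "\<bar>a\<bar> = \<bar>b\<bar>" by simp
  moreover have "a \<noteq> - b"
  proof
    assume "a = - b"
    hence "b * (x\<^sup>2 + y\<^sup>2) = 0" using assms(3) by (simp add: algebra_simps)
    thus False using nz assms(4) by (simp add: sum_power2_eq_zero_iff)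
  qed
  ultimately show ?thesis by linarith
qed

text \<open>Removing the common divisor $g$ from both squarefree parts leaves two coprime factors, whose
  product is squarefree and differs from $d$ by the square of a rational factor, hence equals $d$.\<close>

lemma squarefree_parts_product:
  fixes d e1 e2 :: int
  assumes sf: "squarefree d" "squarefree e1" "squarefree e2"
    and eq: "d * y\<^sup>2 = (e1 * y1\<^sup>2) * (e2 * y2\<^sup>2)" and nz: "y \<noteq> 0"
  shows "\<bar>e1 * e2\<bar> = (gcd e1 e2)\<^sup>2 * \<bar>d\<bar>"
proof -
  define g where "g = gcd e1 e2"
  have e0: "e1 \<noteq> 0" "e2 \<noteq> 0" "d \<noteq> 0" using sf by auto
  have "g dvd e1" "g dvd e2" by (simp_all add: g_def)
  then obtain f1 f2 where f: "e1 = g * f1" "e2 = g * f2" by (auto elim!: dvdE)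
  have g0: "g > 0" using e0 by (simp add: g_def)
  have "gcd (g * f1) (g * f2) = g" using g_def f by metis
  hence "g * gcd f1 f2 = g" using g0 by (simp add: gcd_mult_distrib_int[symmetric])
  hence "coprime f1 f2" using g0 by (simp add: coprime_iff_gcd_eq_1)
  moreover have "squarefree f1" "squarefree f2"
    using sf f by (metis dvd_triv_right squarefree_mono)+
  ultimately have sff: "squarefree (f1 * f2)"
    by (intro squarefree_mult_coprime)
  have eq': "d * y\<^sup>2 = (f1 * f2) * (g * y1 * y2)\<^sup>2"
    unfolding eq f by (simp add: power2_eq_square algebra_simps)
  have "d * y\<^sup>2 \<noteq> 0" using nz e0 by simp
  hence "g * y1 * y2 \<noteq> 0" unfolding eq' by auto
  hence "d = f1 * f2" using squarefree_unique[OF sf(1) sff eq' nz] by simp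
  hence "e1 * e2 = g\<^sup>2 * d" unfolding f by (simp add: power2_eq_square algebra_simps)
  thus ?thesis by (simp add: abs_mult g_def)
qed

section \<open>Growth of integer polynomials\<close>

lemma int_poly_upper_bound:
  fixes p :: "int poly"
  obtains c :: int where "c \<ge> 1" "\<And>w. \<bar>w\<bar> \<ge> 1 \<Longrightarrow> \<bar>poly p w\<bar> \<le> c * \<bar>w\<bar> ^ degree p"
proof (rule that[of "1 + (\<Sum>i\<le>degree p. \<bar>coeff p i\<bar>)"])
  fix w :: int assume w: "\<bar>w\<bar> \<ge> 1"
  have "\<bar>poly p w\<bar> \<le> (\<Sum>i\<le>degree p. \<bar>coeff p i\<bar> * \<bar>w\<bar> ^ i)"
    unfolding poly_altdef by (rule order_trans[OF sum_abs]) (simp add: abs_mult power_abs)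
  also have "\<dots> \<le> (\<Sum>i\<le>degree p. \<bar>coeff p i\<bar> * \<bar>w\<bar> ^ degree p)"
    using w by (intro sum_mono mult_left_mono power_increasing) auto
  also have "\<dots> \<le> (1 + (\<Sum>i\<le>degree p. \<bar>coeff p i\<bar>)) * \<bar>w\<bar> ^ degree p"
    by (simp add: sum_distrib_right[symmetric] algebra_simps)
  finally show "\<bar>poly p w\<bar> \<le> (1 + (\<Sum>i\<le>degree p. \<bar>coeff p i\<bar>)) * \<bar>w\<bar> ^ degree p" .
qed (simp add: sum_nonneg)

lemma int_poly_lower_bound:
  fixes p :: "int poly"
  assumes "p \<noteq> 0"
  obtains W :: int where "W \<ge> 1" "\<And>w. \<bar>w\<bar> \<ge> W \<Longrightarrow> \<bar>w\<bar> ^ degree p \<le> 2 * \<bar>poly p w\<bar>"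
proof (cases "degree p")
  case 0
  then obtain a where a: "p = [:a:]" by (rule degree_eq_zeroE)
  show ?thesis using assms by (intro that[of 1]) (auto simp: a)
next
  case (Suc n)
  define S where "S = (\<Sum>i\<le>n. \<bar>coeff p i\<bar>)"
  have S0: "S \<ge> 0" by (simp add: S_def sum_nonneg)
  show ?thesis
  proof (rule that[of "1 + 2 * S"])
    fix w :: int assume w: "\<bar>w\<bar> \<ge> 1 + 2 * S"
    have eq: "poly p w = coeff p (Suc n) * w ^ Suc n + (\<Sum>i\<le>n. coeff p i * w ^ i)"
      unfolding poly_altdef Suc by simp
    have "\<bar>\<Sum>i\<le>n. coeff p i * w ^ i\<bar> \<le> (\<Sum>i\<le>n. \<bar>coeff p i\<bar> * \<bar>w\<bar> ^ i)"
      by (rule order_trans[OF sum_abs]) (simp add: abs_mult power_abs)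
    also have "\<dots> \<le> (\<Sum>i\<le>n. \<bar>coeff p i\<bar> * \<bar>w\<bar> ^ n)"
      using w S0 by (intro sum_mono mult_left_mono power_increasing) auto
    also have "\<dots> = S * \<bar>w\<bar> ^ n" by (simp add: S_def sum_distrib_right)
    finally have "2 * \<bar>\<Sum>i\<le>n. coeff p i * w ^ i\<bar> \<le> (2 * S) * \<bar>w\<bar> ^ n" by simp
    also have "\<dots> \<le> \<bar>w\<bar> * \<bar>w\<bar> ^ n"
      using w by (intro mult_right_mono) auto
    finally have low: "2 * \<bar>\<Sum>i\<le>n. coeff p i * w ^ i\<bar> \<le> \<bar>w\<bar> ^ Suc n" by simp
    have "coeff p (Suc n) \<noteq> 0" using assms Suc by (metis leading_coeff_0_iff)
    hence "1 * \<bar>w\<bar> ^ Suc n \<le> \<bar>coeff p (Suc n)\<bar> * \<bar>w\<bar> ^ Suc n"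
      by (intro mult_right_mono) auto
    also have "\<dots> = \<bar>coeff p (Suc n) * w ^ Suc n\<bar>" by (simp add: abs_mult power_abs)
    finally have top: "\<bar>w\<bar> ^ Suc n \<le> \<bar>coeff p (Suc n) * w ^ Suc n\<bar>" by simp
    have "\<bar>x\<bar> \<le> \<bar>x + y\<bar> + \<bar>y\<bar>" for x y :: int by simp
    from this[of "coeff p (Suc n) * w ^ Suc n" "\<Sum>i\<le>n. coeff p i * w ^ i"]
    have "\<bar>coeff p (Suc n) * w ^ Suc n\<bar> \<le> \<bar>poly p w\<bar> + \<bar>\<Sum>i\<le>n. coeff p i * w ^ i\<bar>"
      unfolding eq .
    with low top have "\<bar>w\<bar> ^ Suc n \<le> 2 * \<bar>poly p w\<bar>" by linarith
    thus "\<bar>w\<bar> ^ degree p \<le> 2 * \<bar>poly p w\<bar>" unfolding Suc .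
  qed (use S0 in simp)
qed

section \<open>A Belyi map for four rational points\<close>

lemma double_root_dvd:
  fixes R :: "int poly"
  assumes "poly R v = 0" "poly (pderiv R) v = 0"
  shows "[:-v, 1:]\<^sup>2 dvd R"
proof -
  obtain S where S: "R = [:-v, 1:] * S" using assms(1) by (auto simp: poly_eq_0_iff_dvd)
  have "pderiv [:-v, 1:] = [:1:]" by (simp add: pderiv_pCons)
  hence "poly S v = 0" using assms(2) unfolding S pderiv_mult by simp
  then obtain U where "S = [:-v, 1:] * U" by (auto simp: poly_eq_0_iff_dvd)
  hence "R = [:-v, 1:]\<^sup>2 * U" unfolding S power2_eq_square by (simp only: mult.assoc)
  thus ?thesis by simp
qed

text \<open>Every term of the binomial expansion of $(x - y)^{a+b}$ contains $x^a$ or $y^b$.\<close>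

lemma gcd_powers_dvd_difference_power:
  fixes x y :: int
  shows "gcd (x ^ a) (y ^ b) dvd (x - y) ^ (a + b)"
proof -
  let ?g = "gcd (x ^ a) (y ^ b)"
  have "?g dvd of_nat ((a + b) choose k) * x ^ k * (- y) ^ (a + b - k)" if "k \<le> a + b" for k
  proof (cases "a \<le> k")
    case True
    hence "?g dvd x ^ k" by (meson dvd_trans gcd_dvd1 le_imp_power_dvd)
    thus ?thesis by simp
  next
    case False
    hence "y ^ b dvd y ^ (a + b - k)" using that by (intro le_imp_power_dvd) auto
    moreover have "y ^ (a + b - k) dvd (- y) ^ (a + b - k)"
      by (simp add: dvd_power_same)
    ultimately have "?g dvd (- y) ^ (a + b - k)" by (meson dvd_trans gcd_dvd2)
    thus ?thesis by simp
  qed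
  hence "?g dvd (\<Sum>k\<le>a + b. of_nat ((a + b) choose k) * x ^ k * (- y) ^ (a + b - k))"
    by (intro dvd_sum) auto
  also have "\<dots> = (x + - y) ^ (a + b)" by (rule binomial_ring[symmetric])
  finally show ?thesis by simp
qed

lemma gcd_mult_dvd:
  fixes x y \<alpha> \<beta> :: int
  shows "gcd (\<alpha> * x) (\<beta> * y) dvd (\<alpha> * \<beta>) * gcd x y"
proof -
  let ?d = "gcd (\<alpha> * x) (\<beta> * y)"
  have "?d dvd (\<alpha> * x) * \<beta>" "?d dvd (\<beta> * y) * \<alpha>"
    by (rule dvd_mult2[OF gcd_dvd1], rule dvd_mult2[OF gcd_dvd2])
  hence "?d dvd gcd ((\<alpha> * \<beta>) * x) ((\<alpha> * \<beta>) * y)" by (simp add: mult_ac)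
  thus ?thesis by (simp only: gcd_mult_left dvd_normalize_iff)
qed

lemma pderiv_linear_power:
  "poly (pderiv ([:-c, 1:] ^ Suc n)) x = int (Suc n) * (x - c) ^ n"
  by (simp add: pderiv_power_Suc pderiv_pCons algebra_simps del: power_Suc)

text \<open>For integers $i$, $j$ the function $\<phi> = w^i (w - s)^j$ has its zeros and poles among
  $0$, $s$, $\<infinity>$. The numerator of its logarithmic derivative $i/w + j/(w - s)$ is linear in $w$,
  so there is only one critical point besides them, and it lies at $v$ exactly when $i (v - s) + j v = 0$,
  for instance when $i = v$ and $j = s - v$. Then $\<phi>/\<phi>(v)$ sends the four points $0$, $s$, $v$,
  $\<infinity>$ to $0$, $1$, $\<infinity>$, and the fibre over $1$ has a double point at $v$; that double point is
  what makes the abc conjecture give more than a trivial bound.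

  The polynomials $P$ and $Q$ are the numerator and the denominator of $\<phi>/\<phi>(v)$ or of its inverse, cleared of
  denominators in the coefficients; the choice is such that $P$ has the larger degree. A single constant $g$ serves
  for the common factors and for the primes in the coefficients.\<close>

lemma belyi_map_four_points:
  fixes s v :: int
  assumes s: "s \<noteq> 0" and v: "v \<noteq> 0" and sv: "s \<noteq> v"
  obtains P Q :: "int poly" and g :: int
  where "degree P \<ge> 2" "degree Q < degree P" "Q \<noteq> 0" "g \<noteq> 0"
    "[:-v, 1:]\<^sup>2 dvd P - Q"
    "\<And>w. gcd (poly P w) (poly Q w) dvd g"
    "\<And>w p. prime p \<Longrightarrow> p dvd poly P w * poly Q w \<Longrightarrow> p dvd g * (w * (w - s))"
proof -
  \<comment> \<open>The absolute values of the exponents i = v and j = s - v. If these have equal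
    signs, then phi is a polynomial up to inversion; otherwise it is a quotient of
    two powers.\<close>
  define a where "a = nat \<bar>v\<bar>"
  define b where "b = nat \<bar>s - v\<bar>"
  have pos: "a > 0" "b > 0" using v sv by (auto simp: a_def b_def)
  obtain a' b' where ab': "a = Suc a'" "b = Suc b'" using pos by (metis gr0_implies_Suc)
  have ia: "int a = \<bar>v\<bar>" "int b = \<bar>s - v\<bar>" by (auto simp: a_def b_def)
  let ?X = "[:0, 1:] :: int poly" and ?Y = "[:-s, 1:]"
  have X: "poly (pderiv (?X ^ a)) v = int a * v ^ a'"
    using pderiv_linear_power[of 0 a' v] by (simp only: ab') simp
  have Y: "poly (pderiv (?Y ^ b)) v = int b * (v - s) ^ b'"
    using pderiv_linear_power[of s b' v] by (simp only: ab')
  have pow: "v ^ a = v * v ^ a'" "(v - s) ^ b = (v - s) * (v - s) ^ b'"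
    by (simp_all add: ab')
  show ?thesis
  proof (cases "0 < v \<longleftrightarrow> 0 < s - v")
    case True
    hence rel: "int a * (v - s) + int b * v = 0"
      unfolding ia using v sv by (cases "v > 0") (auto simp: algebra_simps)
    define c where "c = v ^ a * (v - s) ^ b"
    define A where "A = ?X ^ a * ?Y ^ b"
    have c0: "c \<noteq> 0" using v sv by (simp add: c_def)
    have deg: "degree A = a + b"
      by (simp add: A_def degree_mult_eq degree_power_eq)
    have A: "poly A w = w ^ a * (w - s) ^ b" for w by (simp add: A_def)
    have "poly (pderiv (A - [:c:])) v = v ^ a * (int b * (v - s) ^ b') + (v - s) ^ b * (int a * v ^ a')"
      by (simp add: A_def pderiv_diff pderiv_mult pderiv_pCons X Y)
    also have "\<dots> = v ^ a' * (v - s) ^ b' * (int a * (v - s) + int b * v)"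
      unfolding pow by (simp only: algebra_simps)
    finally have "poly (pderiv (A - [:c:])) v = 0" using rel by simp
    hence dbl: "[:-v, 1:]\<^sup>2 dvd A - [:c:]"
      by (intro double_root_dvd) (simp_all add: A c_def)
    show ?thesis
    proof (rule that[of A "[:c:]" c])
      show "degree A \<ge> 2" "degree [:c:] < degree A" using deg pos by auto
      show "[:c:] \<noteq> 0" using c0 by simp
      show "gcd (poly A w) (poly [:c:] w) dvd c" for w by simp
      show "p dvd c * (w * (w - s))" if "prime p" "p dvd poly A w * poly [:c:] w" for w p
        using that unfolding A by (auto simp: prime_dvd_mult_iff dest: prime_dvd_power)
    qed (fact c0 dbl)+
  next
    case False
    hence rel: "int a * (v - s) = int b * v"
      unfolding ia using v sv by (cases "v > 0") (auto simp: algebra_simps)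
    have "a \<noteq> b" using rel s pos by auto
    let ?\<alpha> = "(v - s) ^ b" and ?\<beta> = "v ^ a"
    have nz: "?\<alpha> \<noteq> 0" "?\<beta> \<noteq> 0" using v sv by auto
    define A where "A = smult ?\<alpha> (?X ^ a)"
    define B where "B = smult ?\<beta> (?Y ^ b)"
    define g where "g = ?\<alpha> * ?\<beta> * s ^ (a + b)"
    have nz': "A \<noteq> 0" "B \<noteq> 0" using v sv by (auto simp: A_def B_def)
    have g0: "g \<noteq> 0" using v s sv by (simp add: g_def)
    have deg: "degree A = a" "degree B = b"
      using v sv by (auto simp: A_def B_def degree_power_eq)
    have A: "poly A w = ?\<alpha> * w ^ a" and B: "poly B w = ?\<beta> * (w - s) ^ b" for w
      by (simp_all add: A_def B_def)
    have "poly (pderiv (A - B)) v = ?\<alpha> * (int a * v ^ a') - ?\<beta> * (int b * (v - s) ^ b')"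
      by (simp only: A_def B_def pderiv_diff pderiv_smult poly_diff poly_smult X Y)
    also have "\<dots> = v ^ a' * (v - s) ^ b' * (int a * (v - s) - int b * v)"
      unfolding pow by (simp only: algebra_simps)
    finally have "poly (pderiv (A - B)) v = 0" using rel by simp
    hence dbl: "[:-v, 1:]\<^sup>2 dvd A - B"
      by (intro double_root_dvd) (simp_all add: A B)
    hence dbl': "[:-v, 1:]\<^sup>2 dvd B - A" using dvd_minus_iff[of "[:-v, 1:]\<^sup>2" "A - B"] by simp
    have gcd: "gcd (poly A w) (poly B w) dvd g" for w
    proof -
      have "gcd (poly A w) (poly B w) dvd (?\<alpha> * ?\<beta>) * gcd (w ^ a) ((w - s) ^ b)"
        unfolding A B by (rule gcd_mult_dvd)
      also have "\<dots> dvd (?\<alpha> * ?\<beta>) * s ^ (a + b)"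
        using gcd_powers_dvd_difference_power[of w a "w - s" b] by (intro mult_dvd_mono) auto
      finally show ?thesis by (simp only: g_def)
    qed
    have prm: "p dvd g * (w * (w - s))" if "prime p" "p dvd poly A w * poly B w" for p w
      using that unfolding A B g_def by (auto simp: prime_dvd_mult_iff dest: prime_dvd_power)
    show ?thesis
    proof (cases "b < a")
      case True
      show ?thesis
      proof (rule that[of A B g])
        show "degree A \<ge> 2" "degree B < degree A" using True pos deg by auto
      qed (fact nz' g0 dbl gcd prm)+
    next
      case False
      show ?thesis
      proof (rule that[of B A g])
        show "degree B \<ge> 2" "degree A < degree B" using False \<open>a \<noteq> b\<close> pos deg by auto
        show "gcd (poly B w) (poly A w) dvd g" for w using gcd[of w] by (simp add: gcd.commute)
        show "p dvd g * (w * (w - s))" if "prime p" "p dvd poly B w * poly A w" for w p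
          using prm[OF that(1), of w] that(2) by (simp add: mult.commute)
      qed (fact nz' g0 dbl')+
    qed
  qed
qed

section \<open>A lower bound for radicals of cubic values\<close>

lemma abs_quadratic_le:
  fixes A B C X :: int
  assumes "\<bar>X\<bar> \<ge> 1"
  shows "\<bar>A * X\<^sup>2 + B * X + C\<bar> \<le> (\<bar>A\<bar> + \<bar>B\<bar> + \<bar>C\<bar>) * X\<^sup>2"
proof -
  have 1: "\<bar>X\<bar> \<le> X\<^sup>2" using assms mult_right_mono[of 1 "\<bar>X\<bar>" "\<bar>X\<bar>"] by (simp add: power2_eq_square abs_mult[symmetric])
  have "\<bar>A * X\<^sup>2 + B * X + C\<bar> \<le> \<bar>A * X\<^sup>2\<bar> + \<bar>B * X\<bar> + \<bar>C\<bar>" by linarith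
  also have "\<dots> = \<bar>A\<bar> * X\<^sup>2 + \<bar>B\<bar> * \<bar>X\<bar> + \<bar>C\<bar> * 1" by (simp add: abs_mult)
  also have "\<dots> \<le> \<bar>A\<bar> * X\<^sup>2 + \<bar>B\<bar> * X\<^sup>2 + \<bar>C\<bar> * X\<^sup>2"
    using 1 assms by (intro add_mono mult_left_mono) auto
  finally show ?thesis by (simp add: algebra_simps)
qed

text \<open>Without a linear term the identity $A X^2 + C - H(X) = 0$ already has the right shape: both $A X^2$
  and $H(X)$ consist of primes dividing $A X H(X)$, so no auxiliary factors enter the radical.\<close>

lemma radical_exponent_pure:
  fixes A C :: int
  assumes abc: "abc_conjecture" and nz: "A \<noteq> 0" "C \<noteq> 0" and \<epsilon>: "\<epsilon> > (0::real)"
  shows "\<exists>\<kappa>>0. \<exists>X0. \<forall>X::int. \<bar>X\<bar> \<ge> X0 \<longrightarrow>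
      real_of_int \<bar>X\<bar> ^ 2 \<le> \<kappa> * real_of_int (rad (X * (A * X\<^sup>2 + C))) powr (1 + \<epsilon>)"
proof -
  obtain \<kappa> :: real where \<kappa>: "\<kappa> \<ge> 1" and
    abc': "\<And>p q r g :: int. \<lbrakk>p \<noteq> 0; q \<noteq> 0; r \<noteq> 0; p + q + r = 0; g \<noteq> 0; gcd p q dvd g\<rbrakk> \<Longrightarrow>
       real_of_int \<bar>p\<bar> \<le> \<kappa> * real_of_int \<bar>g\<bar> * real_of_int (rad (p * q * r)) powr (1 + \<epsilon>)"
    using abc_with_common_factor[OF abc \<epsilon>] by blast
  show ?thesis
  proof (intro exI conjI allI impI)
    show "\<kappa> * \<bar>C\<bar> * \<bar>A * C\<bar> powr (1 + \<epsilon>) > 0" using \<kappa> nz by simp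
    fix X :: int assume X: "\<bar>X\<bar> \<ge> \<bar>C\<bar> + 1"
    have x1: "\<bar>X\<bar> \<ge> 1" using X by linarith
    have "\<bar>X\<bar> \<le> X\<^sup>2" using x1 mult_right_mono[of 1 "\<bar>X\<bar>" "\<bar>X\<bar>"]
      by (simp add: power2_eq_square abs_mult[symmetric])
    moreover have AX: "X\<^sup>2 \<le> \<bar>A * X\<^sup>2\<bar>"
      using nz mult_right_mono[of 1 "\<bar>A\<bar>" "X\<^sup>2"] by (simp add: abs_mult)
    ultimately have H0: "A * X\<^sup>2 + C \<noteq> 0" using X by linarith
    have X0: "X \<noteq> 0" using x1 by auto
    have "rad ((A * X\<^sup>2) * C * (- (A * X\<^sup>2 + C))) \<le> rad ((A * C) * (X * (A * X\<^sup>2 + C)))"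
    proof (rule rad_mono)
      fix p :: int assume p: "prime p" "p dvd (A * X\<^sup>2) * C * (- (A * X\<^sup>2 + C))"
      hence "p dvd A \<or> p dvd X \<or> p dvd C \<or> p dvd (A * X\<^sup>2 + C)"
        by (simp only: prime_dvd_mult_iff dvd_minus_iff) (auto dest: prime_dvd_power)
      thus "p dvd (A * C) * (X * (A * X\<^sup>2 + C))" by (meson dvd_mult dvd_mult2)
    qed (use nz X0 H0 in simp)
    also have "\<dots> \<le> rad (A * C) * rad (X * (A * X\<^sup>2 + C))"
      using nz X0 H0 by (intro rad_mult_le) auto
    also have "\<dots> \<le> \<bar>A * C\<bar> * rad (X * (A * X\<^sup>2 + C))"
      using nz rad_pos[of "X * (A * X\<^sup>2 + C)"] by (intro mult_right_mono rad_le_abs) auto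
    finally have rad: "real_of_int (rad ((A * X\<^sup>2) * C * (- (A * X\<^sup>2 + C))))
        \<le> real_of_int \<bar>A * C\<bar> * real_of_int (rad (X * (A * X\<^sup>2 + C)))"
      by (simp only: of_int_le_iff of_int_mult[symmetric])
    have "real_of_int \<bar>X\<bar> ^ 2 = real_of_int (X\<^sup>2)" by simp
    also have "\<dots> \<le> real_of_int \<bar>A * X\<^sup>2\<bar>" using AX by (simp only: of_int_le_iff)
    also have "\<dots> \<le> \<kappa> * real_of_int \<bar>C\<bar> *
        real_of_int (rad ((A * X\<^sup>2) * C * (- (A * X\<^sup>2 + C)))) powr (1 + \<epsilon>)"
      using nz X0 H0 by (intro abc') auto
    also have "\<dots> \<le> \<kappa> * real_of_int \<bar>C\<bar> *
        (real_of_int \<bar>A * C\<bar> * real_of_int (rad (X * (A * X\<^sup>2 + C)))) powr (1 + \<epsilon>)"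
      using \<kappa> rad \<epsilon> rad_pos[of "(A * X\<^sup>2) * C * (- (A * X\<^sup>2 + C))"]
      by (intro mult_left_mono powr_mono2) auto
    also have "\<dots> = \<kappa> * \<bar>C\<bar> * \<bar>A * C\<bar> powr (1 + \<epsilon>) * real_of_int (rad (X * (A * X\<^sup>2 + C))) powr (1 + \<epsilon>)"
      using rad_pos[of "X * (A * X\<^sup>2 + C)"] by (simp add: powr_mult)
    finally show "real_of_int \<bar>X\<bar> ^ 2 \<le> \<kappa> * \<bar>C\<bar> * \<bar>A * C\<bar> powr (1 + \<epsilon>) *
        real_of_int (rad (X * (A * X\<^sup>2 + C))) powr (1 + \<epsilon>)" .
  qed
qed

text \<open>Write $H = A X^2 + B X + C$ and $w = 4 A H(X)$. With $s = 4 A C$ and $v = 4 A C - B^2$ one has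
  $w - s = 4 A X (A X + B)$ and $w - v = (2 A X + B)^2$. So $0$ is the image of the roots of $H$, $s$ that of
  $X = 0$, and $v$ is the finite branch point of the quadratic map $X \<mapsto> w$. Composing that map
  with the map of the preceding section gives a relation $P(w) - Q(w) = (2 A X + B)^4 G(w)$. With $N$ the
  degree of $P$, the terms have degree at most $2 N$ in $X$, and exactly $2 N$ for $P(w)$. The primes
  of its terms divide, up to constants, $X H(X)$ or the product
  $(A X + B) (2 A X + B) G(w)$ of degree $1 + 1 + 2 (N - 2) = 2 N - 2$. The abc conjecture thus
  compares $|X|^M$ with the product of the radical of $X H(X)$ and $|X|^{M - 2}$, where $M = 2 N$.
  The hypothesis $B \<noteq> 0$ says that $s \<noteq> v$.\<close>

lemma radical_exponent_mixed:
  fixes A B C :: int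
  assumes abc: "abc_conjecture"
    and nz: "A \<noteq> 0" "B \<noteq> 0" "C \<noteq> 0" "B\<^sup>2 - 4 * A * C \<noteq> 0"
  obtains M :: nat where "M \<ge> 2"
    "\<And>\<epsilon>::real. \<epsilon> > 0 \<Longrightarrow> \<exists>\<kappa>>0. \<exists>X0. \<forall>X::int. \<bar>X\<bar> \<ge> X0 \<longrightarrow>
      real_of_int \<bar>X\<bar> ^ M \<le> \<kappa> *
        (real_of_int (rad (X * (A * X\<^sup>2 + B * X + C))) * real_of_int \<bar>X\<bar> ^ (M - 2)) powr (1 + \<epsilon>)"
proof -
  define s where "s = 4 * A * C"
  define v where "v = 4 * A * C - B\<^sup>2"
  have sv: "s \<noteq> 0" "v \<noteq> 0" "s \<noteq> v" using nz by (auto simp: s_def v_def)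
  obtain P Q :: "int poly" and g :: int where
    degP: "degree P \<ge> 2" and degQ: "degree Q < degree P" and Q0: "Q \<noteq> 0" and g0: "g \<noteq> 0"
    and dbl: "[:-v, 1:]\<^sup>2 dvd P - Q"
    and gcd: "\<And>w. gcd (poly P w) (poly Q w) dvd g"
    and prm: "\<And>w p. prime p \<Longrightarrow> p dvd poly P w * poly Q w \<Longrightarrow> p dvd g * (w * (w - s))"
    using belyi_map_four_points[OF sv] by blast
  define N where "N = degree P"
  obtain G where G: "P - Q = [:-v, 1:]\<^sup>2 * G" using dbl by (elim dvdE)
  have P0: "P \<noteq> 0" using degP by auto
  have degR: "degree (P - Q) = N"
    using degQ degree_add_eq_left[of "- Q" P] by (simp add: N_def)
  have R0: "P - Q \<noteq> 0" using degQ by auto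
  obtain c1 where c1: "c1 \<ge> 1" "\<And>w. \<bar>w\<bar> \<ge> 1 \<Longrightarrow> \<bar>poly (P - Q) w\<bar> \<le> c1 * \<bar>w\<bar> ^ N"
    using int_poly_upper_bound[of "P - Q"] unfolding degR by blast
  obtain W1 where W1: "W1 \<ge> 1" "\<And>w. \<bar>w\<bar> \<ge> W1 \<Longrightarrow> \<bar>w\<bar> ^ N \<le> 2 * \<bar>poly P w\<bar>"
    using int_poly_lower_bound[OF P0] unfolding N_def by blast
  obtain W2 where W2: "W2 \<ge> 1" "\<And>w. \<bar>w\<bar> \<ge> W2 \<Longrightarrow> \<bar>w\<bar> ^ degree Q \<le> 2 * \<bar>poly Q w\<bar>"
    using int_poly_lower_bound[OF Q0] by blast
  obtain W3 where W3: "W3 \<ge> 1" "\<And>w. \<bar>w\<bar> \<ge> W3 \<Longrightarrow> \<bar>w\<bar> ^ N \<le> 2 * \<bar>poly (P - Q) w\<bar>"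
    using int_poly_lower_bound[OF R0] unfolding degR by blast
  define c0 where "c0 = \<bar>4 * A\<bar> * (\<bar>A\<bar> + \<bar>B\<bar> + \<bar>C\<bar>)"
  define c2 where "c2 = c1 * c0 ^ N"
  define c3 where "c3 = \<bar>4 * A * g\<bar> * ((\<bar>A\<bar> + \<bar>B\<bar>) * c2)"
  have c0: "c0 \<ge> 1" using nz unfolding c0_def
    by (smt (verit, ccfv_SIG) abs_mult mult_le_cancel_left1 mult_left_mono)
  have c2: "c2 \<ge> 1" using c0 c1 unfolding c2_def
    by (metis mult_mono' one_le_power mult_1 zero_le_one)
  have c3: "c3 \<ge> 1"
  proof -
    have "c3 > 0" unfolding c3_def using nz g0 c2 by (intro mult_pos_pos) auto
    thus ?thesis by linarith
  qed
  \<comment> \<open>Large enough for the growth bounds of P, Q and P - Q at w, and for w to avoid 0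
    and s.\<close>
  define X0 where "X0 = W1 + W2 + W3 + 2 * \<bar>v\<bar> + 2 * \<bar>s\<bar> + \<bar>B\<bar> + 2"
  have main: "\<bar>poly P w\<bar> > 0 \<and> poly Q w \<noteq> 0 \<and> poly (P - Q) w \<noteq> 0 \<and> \<bar>X\<bar> ^ (2 * N) \<le> 2 ^ (N + 1) * \<bar>poly P w\<bar> \<and>
      rad (poly P w * poly Q w * poly (P - Q) w) \<le> c3 * (rad (X * (A * X\<^sup>2 + B * X + C)) * \<bar>X\<bar> ^ (2 * N - 2))"
    if X: "\<bar>X\<bar> \<ge> X0" and w: "w = 4 * A * (A * X\<^sup>2 + B * X + C)" for X w :: int
  proof -
    define H where "H = A * X\<^sup>2 + B * X + C"
    define Y where "Y = 2 * A * X + B"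
    define L where "L = A * X + B"
    define x where "x = \<bar>X\<bar>"
    have wv: "w - v = Y\<^sup>2" unfolding w v_def Y_def by (simp add: power2_eq_square algebra_simps)
    have ws: "w - s = 4 * A * X * L" unfolding w s_def L_def by (simp add: power2_eq_square algebra_simps)
    have x: "x \<ge> W1 + W2 + W3 + 2 * \<bar>v\<bar> + 2 * \<bar>s\<bar> + \<bar>B\<bar> + 2" using X unfolding X0_def x_def .
    have x1: "x \<ge> 1" using x W1 W2 W3 by linarith
    have xsq: "x \<le> x\<^sup>2" using x1 by (simp add: power2_eq_square)
    have "x \<le> \<bar>A * X\<bar>" using nz mult_right_mono[of 1 "\<bar>A\<bar>" "\<bar>X\<bar>"] unfolding x_def abs_mult by simp
    hence Yx: "x \<le> \<bar>Y\<bar>" unfolding Y_def using x W1 W2 W3 by linarith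
    have Y2: "x\<^sup>2 \<le> Y\<^sup>2" using Yx x1 power_mono[of x "\<bar>Y\<bar>" 2] by simp
    have w_low: "x\<^sup>2 \<le> 2 * \<bar>w\<bar>" using wv Y2 xsq x W1 W2 W3 by linarith
    have w_big: "\<bar>w\<bar> \<ge> W1" "\<bar>w\<bar> \<ge> W2" "\<bar>w\<bar> \<ge> W3" "\<bar>w\<bar> \<ge> \<bar>s\<bar> + 1"
      using wv Y2 xsq x W1 W2 W3 by linarith+
    have w1: "\<bar>w\<bar> \<ge> 1" using w_big W1 by linarith
    have "w \<noteq> 0" "w \<noteq> s" using w_big W1 by auto
    hence nz2: "X \<noteq> 0" "H \<noteq> 0" "L \<noteq> 0" "Y \<noteq> 0"
      using ws w x1 Yx by (auto simp: H_def x_def)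
    have wpos: "\<bar>w\<bar> ^ k > 0" for k using w1 by (intro zero_less_power) linarith
    have P: "poly P w \<noteq> 0" "poly Q w \<noteq> 0" "poly (P - Q) w \<noteq> 0"
      using W1(2)[OF w_big(1)] W2(2)[OF w_big(2)] W3(2)[OF w_big(3)] wpos[of N] wpos[of "degree Q"] by linarith+
    have R: "poly (P - Q) w = Y ^ 4 * poly G w"
    proof -
      have "poly (P - Q) w = (w - v)\<^sup>2 * poly G w"
        unfolding G poly_mult poly_power by simp
      thus ?thesis unfolding wv power_mult[symmetric] by simp
    qed
    have G0: "poly G w \<noteq> 0" using P(3) R by auto
    have "x ^ (2 * N) \<le> (2 * \<bar>w\<bar>) ^ N"
      using w_low unfolding power_mult by (intro power_mono) auto
    also have "\<dots> \<le> 2 ^ N * (2 * \<bar>poly P w\<bar>)"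
      unfolding power_mult_distrib using W1(2)[OF w_big(1)] by (intro mult_left_mono) auto
    finally have height: "x ^ (2 * N) \<le> 2 ^ (N + 1) * \<bar>poly P w\<bar>" by (simp add: mult_ac)
    have wup: "\<bar>w\<bar> \<le> c0 * x\<^sup>2"
    proof -
      have "\<bar>w\<bar> = \<bar>4 * A\<bar> * \<bar>A * X\<^sup>2 + B * X + C\<bar>" unfolding w by (simp only: abs_mult)
      also have "\<dots> \<le> \<bar>4 * A\<bar> * ((\<bar>A\<bar> + \<bar>B\<bar> + \<bar>C\<bar>) * X\<^sup>2)"
        using x1 by (intro mult_left_mono abs_quadratic_le) (auto simp: x_def)
      finally show ?thesis by (simp add: c0_def x_def mult_ac)
    qed
    \<comment> \<open>The cofactor G is bounded through P - Q = Y^4 G, from the upper bound for P - Q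
      and the lower bound for Y.\<close>
    have "\<bar>Y * poly G w\<bar> * x ^ 3 \<le> \<bar>Y * poly G w\<bar> * \<bar>Y\<bar> ^ 3"
      using Yx x1 by (intro mult_left_mono power_mono) auto
    also have "\<dots> = \<bar>poly (P - Q) w\<bar>"
      unfolding R abs_mult power_abs by (simp add: numeral_eq_Suc mult_ac)
    also have "\<dots> \<le> c1 * \<bar>w\<bar> ^ N" by (rule c1(2)[OF w1])
    also have "\<dots> \<le> c1 * (c0 * x\<^sup>2) ^ N"
      using wup c1 by (intro mult_left_mono power_mono) auto
    also have "\<dots> = c2 * x ^ (2 * N)" by (simp add: c2_def power_mult_distrib power_mult)
    also have "\<dots> = c2 * x ^ (2 * N - 3) * x ^ 3"
      using degP unfolding mult.assoc power_add[symmetric] by (simp add: N_def)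
    finally have YG: "\<bar>Y * poly G w\<bar> \<le> c2 * x ^ (2 * N - 3)"
      using x1 by simp
    have Lx: "\<bar>L\<bar> \<le> (\<bar>A\<bar> + \<bar>B\<bar>) * x"
    proof -
      have "\<bar>L\<bar> \<le> \<bar>A * X\<bar> + \<bar>B\<bar> * 1" unfolding L_def by linarith
      also have "\<dots> \<le> \<bar>A\<bar> * x + \<bar>B\<bar> * x"
        using x1 by (intro add_mono mult_left_mono) (auto simp: x_def abs_mult)
      finally show ?thesis by (simp add: algebra_simps)
    qed
    let ?E = "(4 * A * g) * (L * (Y * poly G w))"
    have nzE: "?E \<noteq> 0" "X * H \<noteq> 0" using nz g0 nz2 G0 by auto
    have "rad (poly P w * poly Q w * poly (P - Q) w) \<le> rad (?E * (X * H))"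
    proof (rule rad_mono)
      show "?E * (X * H) \<noteq> 0" using nzE by simp
      fix p :: int assume p: "prime p" "p dvd poly P w * poly Q w * poly (P - Q) w"
      then consider "p dvd poly P w * poly Q w" | "p dvd poly (P - Q) w"
        by (auto simp only: prime_dvd_mult_iff)
      thus "p dvd ?E * (X * H)"
      proof cases
        case 1
        from prm[OF p(1) this] have "p dvd g * ((4 * A * H) * (4 * A * X * L))"
          unfolding ws unfolding w H_def .
        hence "p dvd g \<or> p dvd 4 \<or> p dvd A \<or> p dvd H \<or> p dvd X \<or> p dvd L"
          by (simp only: prime_dvd_mult_iff[OF p(1)]) blast
        thus ?thesis by (meson dvd_mult dvd_mult2)
      next
        case 2
        hence "p dvd Y \<or> p dvd poly G w" unfolding R
          by (simp only: prime_dvd_mult_iff[OF p(1)]) (use p(1) prime_dvd_power in blast)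
        thus ?thesis by (meson dvd_mult dvd_mult2)
      qed
    qed
    also have "\<dots> \<le> rad ?E * rad (X * H)" using nzE by (intro rad_mult_le) auto
    also have "\<dots> \<le> \<bar>?E\<bar> * rad (X * H)"
      using nzE rad_pos[of "X * H"] by (intro mult_right_mono rad_le_abs) auto
    also have "\<dots> = \<bar>4 * A * g\<bar> * (\<bar>L\<bar> * \<bar>Y * poly G w\<bar>) * rad (X * H)"
      by (simp only: abs_mult)
    also have "\<dots> \<le> \<bar>4 * A * g\<bar> * (((\<bar>A\<bar> + \<bar>B\<bar>) * x) * (c2 * x ^ (2 * N - 3))) * rad (X * H)"
      using Lx YG rad_pos[of "X * H"] x1
      by (intro mult_right_mono mult_left_mono mult_mono) auto
    also have "\<dots> = c3 * (rad (X * H) * (x * x ^ (2 * N - 3)))"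
      by (simp only: c3_def mult_ac)
    also have "x * x ^ (2 * N - 3) = x ^ (2 * N - 2)"
      using degP unfolding N_def[symmetric] power_Suc[symmetric]
      by (intro arg_cong[where f = "power x"]) linarith
    finally show ?thesis using P height unfolding x_def H_def by auto
  qed
  show ?thesis
  proof (rule that[of "2 * N"])
    show "2 * N \<ge> 2" using degP by (simp add: N_def)
    fix \<epsilon> :: real assume \<epsilon>: "\<epsilon> > 0"
    obtain \<kappa> :: real where \<kappa>: "\<kappa> \<ge> 1" and
      abc': "\<And>p q r g :: int. \<lbrakk>p \<noteq> 0; q \<noteq> 0; r \<noteq> 0; p + q + r = 0; g \<noteq> 0; gcd p q dvd g\<rbrakk> \<Longrightarrow>
         real_of_int \<bar>p\<bar> \<le> \<kappa> * real_of_int \<bar>g\<bar> * real_of_int (rad (p * q * r)) powr (1 + \<epsilon>)"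
      using abc_with_common_factor[OF abc \<epsilon>] by blast
    define K where "K = 2 ^ (N + 1) * (\<kappa> * real_of_int \<bar>g\<bar> * real_of_int c3 powr (1 + \<epsilon>))"
    show "\<exists>\<kappa>>0. \<exists>X0. \<forall>X::int. \<bar>X\<bar> \<ge> X0 \<longrightarrow>
      real_of_int \<bar>X\<bar> ^ (2 * N) \<le> \<kappa> *
        (real_of_int (rad (X * (A * X\<^sup>2 + B * X + C))) * real_of_int \<bar>X\<bar> ^ (2 * N - 2)) powr (1 + \<epsilon>)"
    proof (intro exI[of _ K] conjI exI[of _ X0] allI impI)
      show "K > 0" using \<kappa> g0 c3 by (simp add: K_def)
      fix X :: int assume X: "\<bar>X\<bar> \<ge> X0"
      define w where "w = 4 * A * (A * X\<^sup>2 + B * X + C)"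
      define \<rho> where "\<rho> = real_of_int (rad (X * (A * X\<^sup>2 + B * X + C))) * real_of_int \<bar>X\<bar> ^ (2 * N - 2)"
      have \<rho>0: "\<rho> \<ge> 0" using rad_pos[of "X * (A * X\<^sup>2 + B * X + C)"] by (simp add: \<rho>_def)
      note m = main[OF X w_def]
      let ?r = "rad (poly P w * poly Q w * poly (P - Q) w)"
      have "real_of_int ?r \<le> real_of_int (c3 * (rad (X * (A * X\<^sup>2 + B * X + C)) * \<bar>X\<bar> ^ (2 * N - 2)))"
        using m by (simp only: of_int_le_iff)
      hence r: "real_of_int ?r \<le> real_of_int c3 * \<rho>" by (simp add: \<rho>_def)
      have "real_of_int \<bar>poly P w\<bar> \<le> \<kappa> * real_of_int \<bar>g\<bar> *
          real_of_int (rad (poly P w * (- poly Q w) * (- poly (P - Q) w))) powr (1 + \<epsilon>)"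
        using m g0 gcd[of w] by (intro abc') auto
      also have "poly P w * (- poly Q w) * (- poly (P - Q) w) = poly P w * poly Q w * poly (P - Q) w"
        by (simp only: mult_minus_left mult_minus_right minus_minus)
      also have "\<kappa> * real_of_int \<bar>g\<bar> * real_of_int ?r powr (1 + \<epsilon>)
          \<le> \<kappa> * real_of_int \<bar>g\<bar> * (real_of_int c3 * \<rho>) powr (1 + \<epsilon>)"
        using r \<kappa> \<epsilon> rad_pos[of "poly P w * poly Q w * poly (P - Q) w"]
        by (intro mult_left_mono powr_mono2) auto
      also have "\<dots> = \<kappa> * real_of_int \<bar>g\<bar> * real_of_int c3 powr (1 + \<epsilon>) * \<rho> powr (1 + \<epsilon>)"
        using c3 \<rho>0 by (simp add: powr_mult)
      finally have 1: "real_of_int \<bar>poly P w\<bar> \<le> \<kappa> * real_of_int \<bar>g\<bar> * real_of_int c3 powr (1 + \<epsilon>) * \<rho> powr (1 + \<epsilon>)" .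
      have "real_of_int (\<bar>X\<bar> ^ (2 * N)) \<le> real_of_int (2 ^ (N + 1) * \<bar>poly P w\<bar>)"
        using m by (simp only: of_int_le_iff)
      hence "real_of_int \<bar>X\<bar> ^ (2 * N) \<le> 2 ^ (N + 1) * real_of_int \<bar>poly P w\<bar>" by simp
      also have "\<dots> \<le> 2 ^ (N + 1) * (\<kappa> * real_of_int \<bar>g\<bar> * real_of_int c3 powr (1 + \<epsilon>) * \<rho> powr (1 + \<epsilon>))"
        using 1 by (intro mult_left_mono) auto
      also have "\<dots> = K * \<rho> powr (1 + \<epsilon>)" by (simp add: K_def)
      finally show "real_of_int \<bar>X\<bar> ^ (2 * N) \<le> K *
        (real_of_int (rad (X * (A * X\<^sup>2 + B * X + C))) * real_of_int \<bar>X\<bar> ^ (2 * N - 2)) powr (1 + \<epsilon>)"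
        by (simp only: \<rho>_def)
    qed
  qed
qed

section \<open>The height of integral points under abc\<close>

text \<open>The exponent $M$ depends on the cubic but not on $\<epsilon>$, which allows $\<epsilon>$ to be chosen small in
  terms of $M$ afterwards.\<close>

lemma radical_exponent:
  fixes A B C :: int
  assumes abc: "abc_conjecture"
    and nz: "A \<noteq> 0" "C \<noteq> 0" "B\<^sup>2 - 4 * A * C \<noteq> 0"
  obtains M :: nat where "M \<ge> 2"
    "\<And>\<epsilon>::real. \<epsilon> > 0 \<Longrightarrow> \<exists>\<kappa>>0. \<exists>X0. \<forall>X::int. \<bar>X\<bar> \<ge> X0 \<longrightarrow>
      real_of_int \<bar>X\<bar> ^ M \<le> \<kappa> *
        (real_of_int (rad (X * (A * X\<^sup>2 + B * X + C))) * real_of_int \<bar>X\<bar> ^ (M - 2)) powr (1 + \<epsilon>)"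
proof (cases "B = 0")
  case True
  show ?thesis
    using radical_exponent_pure[OF abc nz(1,2)] True by (intro that[of 2]) simp_all
next
  case False
  show ?thesis using radical_exponent_mixed[OF abc nz(1) False nz(2,3)] that by blast
qed

text \<open>Let $\<rho>$ be the radical of $X H(X) = d Y^2$. Up to $\<epsilon>$ in the exponents, $|X|^M$ is at most
  $\<rho> |X|^{M-2}$, so $\<rho>$ is at least $|X|^2$. On the other hand $\<rho>^2 \<le> d^2 Y^2 = |d| |X H(X)|$, which is
  of order at most $|d| |X|^3$. Comparing the two gives $|X|$ at most about $|d|$.\<close>

lemma abc_height_bound:
  fixes A B C :: int and \<delta> :: real
  assumes abc: "abc_conjecture"
    and nz: "A \<noteq> 0" "C \<noteq> 0" "B\<^sup>2 - 4 * A * C \<noteq> 0" and \<delta>: "\<delta> > 0"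
  obtains K :: real where "K \<ge> 1"
    "\<And>d X Y :: int. \<lbrakk>d \<noteq> 0; Y \<noteq> 0; d * Y\<^sup>2 = X * (A * X\<^sup>2 + B * X + C)\<rbrakk>
       \<Longrightarrow> real_of_int \<bar>X\<bar> \<le> K * real_of_int \<bar>d\<bar> powr (1 + \<delta>)"
proof -
  obtain M :: nat where M: "M \<ge> 2" and ex: "\<And>\<epsilon>::real. \<epsilon> > 0 \<Longrightarrow> \<exists>\<kappa>>0. \<exists>X0. \<forall>X::int. \<bar>X\<bar> \<ge> X0 \<longrightarrow>
      real_of_int \<bar>X\<bar> ^ M \<le> \<kappa> *
        (real_of_int (rad (X * (A * X\<^sup>2 + B * X + C))) * real_of_int \<bar>X\<bar> ^ (M - 2)) powr (1 + \<epsilon>)"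
    using radical_exponent[OF abc nz] by blast
  define m :: real where "m = 2 * real M - 1"
  have m: "m \<ge> 3" using M by (simp add: m_def)
  \<comment> \<open>Squaring the abc bound and inserting the upper bound for the radical leaves
    x^eta of order at most |d|^(1 + epsilon) with eta = 1 - m epsilon. This choice
    of epsilon makes the quotient of the two exponents equal to 1 + delta.\<close>
  define \<epsilon> where "\<epsilon> = \<delta> / (1 + (1 + \<delta>) * m)"
  have \<epsilon>: "\<epsilon> > 0" unfolding \<epsilon>_def using m \<delta> by (intro divide_pos_pos add_pos_pos mult_pos_pos) auto
  define \<eta> where "\<eta> = 1 - m * \<epsilon>"
  have den: "1 + (1 + \<delta>) * m > 0" using m \<delta> by (intro add_pos_pos mult_pos_pos) auto
  have \<eta>\<epsilon>: "(1 + \<delta>) * \<eta> = 1 + \<epsilon>"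
  proof -
    have "\<epsilon> * (1 + (1 + \<delta>) * m) = \<delta>" using den by (simp add: \<epsilon>_def)
    thus ?thesis unfolding \<eta>_def by (simp add: algebra_simps)
  qed
  have \<eta>: "\<eta> > 0"
    using \<eta>\<epsilon> \<epsilon> \<delta> zero_less_mult_iff[of "1 + \<delta>" \<eta>] by linarith
  obtain \<kappa> X0 where \<kappa>: "\<kappa> > 0" and bd: "\<And>X::int. \<bar>X\<bar> \<ge> X0 \<Longrightarrow> real_of_int \<bar>X\<bar> ^ M \<le> \<kappa> *
        (real_of_int (rad (X * (A * X\<^sup>2 + B * X + C))) * real_of_int \<bar>X\<bar> ^ (M - 2)) powr (1 + \<epsilon>)"
    using ex[OF \<epsilon>] by blast
  define c where "c = real_of_int (\<bar>A\<bar> + \<bar>B\<bar> + \<bar>C\<bar>)"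
  have c: "c > 0" using nz by (simp add: c_def)
  define k where "k = \<kappa>\<^sup>2 * c powr (1 + \<epsilon>)"
  have k: "k > 0" using \<kappa> c by (simp add: k_def)
  define K where "K = 1 + real_of_int \<bar>X0\<bar> + k powr (1 / \<eta>)"
  show ?thesis
  proof (rule that[of K])
    show "K \<ge> 1" by (simp add: K_def)
    fix d X Y :: int
    assume d: "d \<noteq> 0" and Y: "Y \<noteq> 0" and eq: "d * Y\<^sup>2 = X * (A * X\<^sup>2 + B * X + C)"
    define H where "H = A * X\<^sup>2 + B * X + C"
    define x where "x = real_of_int \<bar>X\<bar>"
    define t where "t = real_of_int \<bar>d\<bar>"
    have t: "t \<ge> 1" using d by (simp add: t_def)
    have td: "t powr (1 + \<delta>) \<ge> 1" using t \<delta> by (intro ge_one_powr_ge_zero) auto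
    have X: "X \<noteq> 0" using eq d Y by auto
    have x: "x \<ge> 1" using X by (simp add: x_def)
    show "x \<le> K * t powr (1 + \<delta>)"
    \<comment> \<open>Small X are absorbed by the constant K, since |d| is at least 1.\<close>
    proof (cases "\<bar>X\<bar> \<ge> X0")
      case False
      hence "x \<le> K" unfolding x_def K_def using powr_ge_zero[of k "1 / \<eta>"] by linarith
      also have "K * 1 \<le> K * t powr (1 + \<delta>)" using td k by (intro mult_left_mono) (auto simp: K_def)
      finally show ?thesis by simp
    next
      case True
      define \<rho> where "\<rho> = real_of_int (rad (X * H))"
      have \<rho>0: "\<rho> > 0" using rad_pos by (simp add: \<rho>_def)
      have "rad (X * H) \<le> \<bar>d\<bar> * \<bar>Y\<bar>"
        using rad_mult_square_le[OF d Y] unfolding eq H_def .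
      hence "(rad (X * H))\<^sup>2 \<le> (\<bar>d\<bar> * \<bar>Y\<bar>)\<^sup>2"
        using rad_pos[of "X * H"] by (intro power_mono) auto
      also have "\<dots> = \<bar>d\<bar> * \<bar>d * Y\<^sup>2\<bar>" by (simp add: power2_eq_square abs_mult mult_ac)
      also have "\<dots> = \<bar>d\<bar> * (\<bar>X\<bar> * \<bar>H\<bar>)" by (simp only: eq H_def abs_mult)
      also have "\<dots> \<le> \<bar>d\<bar> * (\<bar>X\<bar> * ((\<bar>A\<bar> + \<bar>B\<bar> + \<bar>C\<bar>) * X\<^sup>2))"
        using X unfolding H_def by (intro mult_left_mono abs_quadratic_le) auto
      finally have "real_of_int ((rad (X * H))\<^sup>2) \<le> real_of_int (\<bar>d\<bar> * (\<bar>X\<bar> * ((\<bar>A\<bar> + \<bar>B\<bar> + \<bar>C\<bar>) * X\<^sup>2)))"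
        by (simp only: of_int_le_iff)
      hence \<rho>2: "\<rho>\<^sup>2 \<le> c * t * x ^ 3"
        by (simp add: \<rho>_def t_def c_def x_def power2_eq_square power3_eq_cube mult_ac flip: abs_mult)
      have 1: "x ^ M \<le> \<kappa> * (\<rho> * x ^ (M - 2)) powr (1 + \<epsilon>)"
        using bd[OF True] by (simp only: x_def \<rho>_def H_def)
      have "(x ^ M)\<^sup>2 \<le> (\<kappa> * (\<rho> * x ^ (M - 2)) powr (1 + \<epsilon>))\<^sup>2"
        using 1 x by (intro power_mono) auto
      also have "\<dots> = \<kappa>\<^sup>2 * ((\<rho> * x ^ (M - 2))\<^sup>2) powr (1 + \<epsilon>)"
        using \<rho>0 x by (simp add: power2_eq_square powr_mult)
      also have "\<dots> \<le> \<kappa>\<^sup>2 * (c * t * x ^ (2 * M - 1)) powr (1 + \<epsilon>)"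
      proof -
        have "(\<rho> * x ^ (M - 2))\<^sup>2 = \<rho>\<^sup>2 * x ^ (2 * M - 4)"
          by (simp add: power_mult_distrib power_mult[symmetric] mult.commute algebra_simps)
        also have "\<dots> \<le> c * t * x ^ 3 * x ^ (2 * M - 4)"
          using \<rho>2 x by (intro mult_right_mono) auto
        also have "\<dots> = c * t * x ^ (2 * M - 1)"
          using M unfolding mult.assoc power_add[symmetric] by simp
        finally show ?thesis using \<kappa> \<epsilon> by (intro mult_left_mono powr_mono2) auto
      qed
      also have "\<dots> = k * t powr (1 + \<epsilon>) * (x powr m) powr (1 + \<epsilon>)"
      proof -
        have "x ^ (2 * M - 1) = x powr m" using x M powr_realpow[of x "2 * M - 1"] by (simp add: m_def of_nat_diff)
        thus ?thesis using c t x by (simp add: k_def powr_mult)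
      qed
      finally have 2: "(x ^ M)\<^sup>2 \<le> k * t powr (1 + \<epsilon>) * x powr (m * (1 + \<epsilon>))"
        by (simp add: powr_powr)
      have "(x ^ M)\<^sup>2 = x ^ (M * 2)" by (rule power_mult[symmetric])
      also have "\<dots> = x powr real (M * 2)" using x by (intro powr_realpow[symmetric]) simp
      also have "real (M * 2) = m + 1" by (simp add: m_def)
      also have "x powr (m + 1) = x powr (\<eta> + m * (1 + \<epsilon>))" by (simp add: \<eta>_def algebra_simps)
      also have "\<dots> = x powr \<eta> * x powr (m * (1 + \<epsilon>))"
        by (rule powr_add)
      finally have "x powr \<eta> * x powr (m * (1 + \<epsilon>)) \<le> k * t powr (1 + \<epsilon>) * x powr (m * (1 + \<epsilon>))"
        using 2 by simp
      hence 3: "x powr \<eta> \<le> k * t powr (1 + \<epsilon>)" using x by simp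
      have "x = (x powr \<eta>) powr (1 / \<eta>)" using x \<eta> by (simp add: powr_powr)
      also have "\<dots> \<le> (k * t powr (1 + \<epsilon>)) powr (1 / \<eta>)" using 3 \<eta> by (intro powr_mono2) auto
      also have "\<dots> = k powr (1 / \<eta>) * t powr ((1 + \<epsilon>) / \<eta>)" using k t by (simp add: powr_mult powr_powr)
      also have "(1 + \<epsilon>) / \<eta> = 1 + \<delta>" using \<eta>\<epsilon> \<eta> by (simp add: field_simps)
      also have "k powr (1 / \<eta>) * t powr (1 + \<delta>) \<le> K * t powr (1 + \<delta>)"
        by (intro mult_right_mono) (auto simp: K_def)
      finally show ?thesis .
    qed
  qed
qed

section \<open>Solutions of Pell equations with a fixed right-hand side\<close>

text \<open>For two solutions in the same class modulo $k$, the quotient of $u' + y' \<surd>m$ by $u + y \<surd>m$ is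
  $s + t \<surd>m$ with integers $s$, $t$ satisfying $s^2 - m t^2 = 1$. It exceeds $1$, so $s$ and $t$ are
  positive, and then $s \<ge> 2$ and $u' = s u + m t y \<ge> 2 u$. The argument is written with integers only,
  which covers square values of $m$ as well.\<close>

lemma pell_orbit_gap:
  fixes u y u' y' m k :: int
  assumes k: "k \<noteq> 0" and m: "m > 0"
    and sol: "u\<^sup>2 - m * y\<^sup>2 = k" "u'\<^sup>2 - m * y'\<^sup>2 = k"
    and pos: "u > 0" "y > 0" "y' > 0" and lt: "u < u'"
    and cong: "k dvd u' - u" "k dvd y' - y"
  shows "2 * u \<le> u'"
proof -
  have "k dvd u * u' - m * y * y'"
  proof -
    have "u * u' - m * y * y' = k + (u * (u' - u) - m * y * (y' - y))"
      unfolding sol(1)[symmetric] by (simp add: power2_eq_square algebra_simps)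
    thus ?thesis using cong by simp
  qed
  then obtain s where s: "u * u' - m * y * y' = k * s" by (elim dvdE)
  have "k dvd u * y' - u' * y"
  proof -
    have "u * y' - u' * y = u * (y' - y) - y * (u' - u)" by (simp add: algebra_simps)
    thus ?thesis using cong by simp
  qed
  then obtain t where t: "u * y' - u' * y = k * t" by (elim dvdE)
  have "k * u' = k * (s * u + m * t * y)"
  proof -
    have "k * (s * u + m * t * y) = (k * s) * u + m * (k * t) * y" by (simp add: algebra_simps)
    also have "\<dots> = u' * (u\<^sup>2 - m * y\<^sup>2)"
      unfolding s[symmetric] t[symmetric] by (simp add: power2_eq_square algebra_simps)
    finally show ?thesis unfolding sol(1) by (simp only: mult.commute)
  qed
  hence u': "u' = s * u + m * t * y" using k by simp
  have "k * u = k * (s * u' - m * t * y')"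
  proof -
    have "k * (s * u' - m * t * y') = (k * s) * u' - m * (k * t) * y'" by (simp add: algebra_simps)
    also have "\<dots> = u * (u'\<^sup>2 - m * y'\<^sup>2)"
      unfolding s[symmetric] t[symmetric] by (simp add: power2_eq_square algebra_simps)
    finally show ?thesis unfolding sol(2) by (simp only: mult.commute)
  qed
  hence u: "u = s * u' - m * t * y'" using k by simp
  have "k\<^sup>2 * (s\<^sup>2 - m * t\<^sup>2) = k\<^sup>2 * 1"
  proof -
    have "k\<^sup>2 * (s\<^sup>2 - m * t\<^sup>2) = (k * s)\<^sup>2 - m * (k * t)\<^sup>2" by (simp add: power_mult_distrib algebra_simps)
    also have "\<dots> = (u\<^sup>2 - m * y\<^sup>2) * (u'\<^sup>2 - m * y'\<^sup>2)"
      unfolding s[symmetric] t[symmetric] by (simp add: power2_eq_square algebra_simps)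
    finally show ?thesis unfolding sol by (simp add: power2_eq_square)
  qed
  hence norm: "s\<^sup>2 = 1 + m * t\<^sup>2" using k by simp
  \<comment> \<open>The signs of s and t follow from u < u' by expressing each solution through the
    other.\<close>
  have t0: "t \<noteq> 0"
  proof
    assume "t = 0"
    hence "s = 1 \<or> s = -1" using norm by (simp add: power2_eq_1_iff)
    thus False using u' \<open>t = 0\<close> lt pos by auto
  qed
  have s0: "s > 0"
  proof (rule ccontr)
    assume "\<not> s > 0"
    hence "s * u \<le> 0" "s * u' \<le> 0" using pos lt by (auto intro: mult_nonpos_nonneg)
    hence "m * t * y > 0" "m * t * y' < 0" using u u' pos lt by linarith+
    thus False using m pos by (auto simp: zero_less_mult_iff mult_less_0_iff)
  qed
  have "m * t\<^sup>2 \<ge> 1" using m t0 by (simp add: int_one_le_iff_zero_less)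
  hence "s\<^sup>2 > 1\<^sup>2" using norm by simp
  hence s2: "s \<ge> 2" using s0 power_less_imp_less_base[of 1 2 s] by simp
  have "t > 0"
  proof (rule ccontr)
    assume "\<not> t > 0"
    hence "m * t * y' \<le> 0" using m pos by (intro mult_nonpos_nonneg mult_nonneg_nonpos) auto
    moreover have "2 * u' \<le> s * u'" using s2 pos lt by (intro mult_right_mono) auto
    ultimately show False using u lt pos by linarith
  qed
  hence "m * t * y \<ge> 0" using m pos by simp
  moreover have "2 * u \<le> s * u" using s2 pos by (intro mult_right_mono) auto
  ultimately show ?thesis using u' by linarith
qed

text \<open>Elements of the same class that at least double from one to the next have different binary logarithms
  after rounding down, so an element is determined by its class and that rounded logarithm.\<close>

lemma card_doubling_set_le:
  fixes S :: "int set" and cl :: "int \<Rightarrow> 'a" and U :: real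
  assumes fin: "finite L" and cl: "cl ` S \<subseteq> L"
    and range: "\<And>u. u \<in> S \<Longrightarrow> u > 0 \<and> real_of_int u \<le> U" and U: "U \<ge> 1"
    and gap: "\<And>u u'. \<lbrakk>u \<in> S; u' \<in> S; cl u = cl u'; u < u'\<rbrakk> \<Longrightarrow> 2 * u \<le> u'"
  shows "finite S" "real (card S) \<le> real (card L) * (log 2 U + 1)"
proof -
  define f where "f u = (cl u, nat \<lfloor>log 2 (real_of_int u)\<rfloor>)" for u
  have log0: "log 2 (real_of_int u) \<ge> 0" if "u \<in> S" for u using range[OF that] by simp
  have ne: "f u \<noteq> f u'" if "u \<in> S" "u' \<in> S" "u < u'" for u u'
  proof
    assume eq: "f u = f u'"
    have "2 * u \<le> u'" using gap[of u u'] that eq by (simp add: f_def)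
    hence "log 2 (real_of_int (2 * u)) \<le> log 2 (real_of_int u')"
      using range[OF that(1)] range[OF that(2)] by simp
    hence "1 + log 2 (real_of_int u) \<le> log 2 (real_of_int u')"
      using range[OF that(1)] by (simp add: log_mult)
    hence "\<lfloor>log 2 (real_of_int u)\<rfloor> + 1 \<le> \<lfloor>log 2 (real_of_int u')\<rfloor>" by linarith
    moreover have "\<lfloor>log 2 (real_of_int u)\<rfloor> \<ge> 0" using log0[OF that(1)] by simp
    moreover have "nat \<lfloor>log 2 (real_of_int u)\<rfloor> = nat \<lfloor>log 2 (real_of_int u')\<rfloor>"
      using eq by (simp add: f_def)
    ultimately show False by linarith
  qed
  hence inj: "inj_on f S" by (metis inj_onI linorder_neqE)
  let ?T = "L \<times> {..nat \<lfloor>log 2 U\<rfloor>}"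
  have sub: "f ` S \<subseteq> ?T"
  proof
    fix z assume "z \<in> f ` S"
    then obtain u where u: "u \<in> S" "z = f u" by auto
    have "log 2 (real_of_int u) \<le> log 2 U" using range[OF u(1)] U by (subst log_le_cancel_iff) auto
    hence "nat \<lfloor>log 2 (real_of_int u)\<rfloor> \<le> nat \<lfloor>log 2 U\<rfloor>" by (intro nat_mono floor_mono)
    thus "z \<in> ?T" using u cl by (auto simp: f_def)
  qed
  have finT: "finite ?T" using fin by simp
  show "finite S" using finite_subset[OF sub finT] inj by (simp add: finite_image_iff)
  have "card S = card (f ` S)" using inj by (simp add: card_image)
  also have "\<dots> \<le> card ?T" using sub finT by (intro card_mono)
  also have "\<dots> = card L * (nat \<lfloor>log 2 U\<rfloor> + 1)" by (simp add: card_cartesian_product)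
  finally have "real (card S) \<le> real (card L * (nat \<lfloor>log 2 U\<rfloor> + 1))"
    by (simp only: of_nat_le_iff)
  also have "\<dots> \<le> real (card L) * (log 2 U + 1)"
  proof -
    have "log 2 U \<ge> 0" using U by simp
    hence "real (nat \<lfloor>log 2 U\<rfloor>) \<le> log 2 U" by simp
    thus ?thesis unfolding of_nat_mult by (intro mult_left_mono) auto
  qed
  finally show "real (card S) \<le> real (card L) * (log 2 U + 1)" .
qed

text \<open>The constant depends on $k$ alone: there are at most $k^2$ residue classes of solutions modulo
  $k$, whatever $m$ is. For negative $m$ the equation itself bounds $u$.\<close>

lemma card_pell_solutions_le:
  fixes k :: int
  assumes k: "k \<noteq> 0"
  obtains c :: real where "c \<ge> 0"
    "\<And>(m::int) (U::real). \<lbrakk>m \<noteq> 0; U \<ge> 1\<rbrakk> \<Longrightarrow>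
       finite {u. real_of_int \<bar>u\<bar> \<le> U \<and> (\<exists>y. y \<noteq> 0 \<and> u\<^sup>2 - m * y\<^sup>2 = k)} \<and>
       real (card {u. real_of_int \<bar>u\<bar> \<le> U \<and> (\<exists>y. y \<noteq> 0 \<and> u\<^sup>2 - m * y\<^sup>2 = k)}) \<le> c * (log 2 U + 1)"
proof -
  let ?c = "2 * real_of_int (k\<^sup>2) + (2 * real_of_int \<bar>k\<bar> + 1)"
  show ?thesis
  proof (rule that[of ?c])
    fix m :: int and U :: real
    assume m: "m \<noteq> 0" and U: "U \<ge> 1"
    let ?S = "{u. real_of_int \<bar>u\<bar> \<le> U \<and> (\<exists>y. y \<noteq> 0 \<and> u\<^sup>2 - m * y\<^sup>2 = k)}"
    let ?I = "{-\<bar>k\<bar>..\<bar>k\<bar>}"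
    have log0: "log 2 U \<ge> 0" using U by simp
    have cI: "real (card ?I) = 2 * real_of_int \<bar>k\<bar> + 1" by simp
    show "finite ?S \<and> real (card ?S) \<le> ?c * (log 2 U + 1)"
    proof (cases "m > 0")
      case False
      have "?S \<subseteq> ?I"
      proof
        fix u assume "u \<in> ?S"
        then obtain y where y: "u\<^sup>2 - m * y\<^sup>2 = k" by auto
        have "m * y\<^sup>2 \<le> 0" using False by (intro mult_nonpos_nonneg) auto
        hence "u\<^sup>2 \<le> \<bar>k\<bar>" using y by linarith
        moreover have "\<bar>u\<bar> \<le> u\<^sup>2" using self_le_power[of "\<bar>u\<bar>" 2] by (cases "u = 0") auto
        ultimately show "u \<in> ?I" by auto
      qed
      moreover have "finite ?I" by simp
      ultimately have "finite ?S" "card ?S \<le> card ?I"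
        by (rule finite_subset, rule card_mono[rotated])
      hence "real (card ?S) \<le> (2 * real_of_int \<bar>k\<bar> + 1) * 1" using cI by simp
      also have "\<dots> \<le> ?c * (log 2 U + 1)" using log0 by (intro mult_mono) auto
      finally show ?thesis using \<open>finite ?S\<close> by simp
    next
      case True
      define S where "S = {u. u > 0 \<and> real_of_int u \<le> U \<and> (\<exists>y>0. u\<^sup>2 - m * y\<^sup>2 = k)}"
      \<comment> \<open>The residue class of a solution involves both coordinates, so a positive y is
        fixed for every u.\<close>
      define yy where "yy u = (SOME y. y > 0 \<and> u\<^sup>2 - m * y\<^sup>2 = k)" for u
      have yy: "yy u > 0 \<and> u\<^sup>2 - m * (yy u)\<^sup>2 = k" if "u \<in> S" for u
        using that unfolding S_def yy_def by (metis (mono_tags, lifting) mem_Collect_eq someI_ex)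
      let ?cl = "\<lambda>u. (u mod \<bar>k\<bar>, yy u mod \<bar>k\<bar>)"
      let ?L = "{0..<\<bar>k\<bar>} \<times> {0..<\<bar>k\<bar>}"
      have cL: "real (card ?L) = real_of_int (k\<^sup>2)"
        by (simp add: card_cartesian_product power2_eq_square)
      have S: "finite S" "real (card S) \<le> real (card ?L) * (log 2 U + 1)"
      proof (atomize(full), intro conjI)
        have gap: "2 * u \<le> u'" if "u \<in> S" "u' \<in> S" "?cl u = ?cl u'" "u < u'" for u u'
        proof (rule pell_orbit_gap[of k m u "yy u" u' "yy u'"])
          have "u' mod \<bar>k\<bar> = u mod \<bar>k\<bar>" "yy u' mod \<bar>k\<bar> = yy u mod \<bar>k\<bar>"
            using that(3) by simp_all
          thus "k dvd u' - u" "k dvd yy u' - yy u"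
            by (simp_all only: mod_eq_dvd_iff abs_dvd_iff)
        qed (use k True yy[OF that(1)] yy[OF that(2)] that in \<open>auto simp: S_def\<close>)
        have img: "?cl ` S \<subseteq> ?L" using k by auto
        have rng: "u > 0 \<and> real_of_int u \<le> U" if "u \<in> S" for u using that by (simp add: S_def)
        have fL: "finite ?L" by simp
        show "finite S" by (rule card_doubling_set_le(1)[OF fL img rng U gap])
        show "real (card S) \<le> real (card ?L) * (log 2 U + 1)"
          by (rule card_doubling_set_le(2)[OF fL img rng U gap])
      qed
      have sub: "?S \<subseteq> S \<union> uminus ` S \<union> {0}"
      proof
        fix u assume "u \<in> ?S"
        then obtain y where y: "y \<noteq> 0" "u\<^sup>2 - m * y\<^sup>2 = k" "real_of_int \<bar>u\<bar> \<le> U" by auto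
        hence "\<exists>y>0. \<bar>u\<bar>\<^sup>2 - m * y\<^sup>2 = k" by (intro exI[of _ "\<bar>y\<bar>"]) auto
        hence "u = 0 \<or> \<bar>u\<bar> \<in> S" using y by (auto simp: S_def)
        thus "u \<in> S \<union> uminus ` S \<union> {0}"
          by (cases "u \<ge> 0") (auto simp: image_iff intro!: bexI[of _ "- u"])
      qed
      have fin: "finite (S \<union> uminus ` S \<union> {0})" using S by simp
      have "card ?S \<le> card (S \<union> uminus ` S \<union> {0})" by (rule card_mono[OF fin sub])
      also have "\<dots> \<le> card S + card (uminus ` S) + card {0::int}"
        by (meson add_mono card_Un_le order_trans order_refl)
      also have "\<dots> \<le> card S + card S + 1" using card_image_le[OF S(1), of uminus] by simp
      finally have "real (card ?S) \<le> 2 * real (card S) + 1" by simp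
      also have "\<dots> \<le> 2 * (real_of_int (k\<^sup>2) * (log 2 U + 1)) + (2 * real_of_int \<bar>k\<bar> + 1) * (log 2 U + 1)"
      proof (intro add_mono mult_left_mono)
        have "1 * 1 \<le> (2 * real_of_int \<bar>k\<bar> + 1) * (log 2 U + 1)"
          using log0 by (intro mult_mono) auto
        thus "1 \<le> (2 * real_of_int \<bar>k\<bar> + 1) * (log 2 U + 1)" by simp
      qed (use S(2) cL in auto)
      also have "\<dots> = ?c * (log 2 U + 1)" by (simp add: algebra_simps)
      finally show ?thesis using finite_subset[OF sub fin] by simp
    qed
  qed simp
qed

section \<open>Counting abscissae\<close>

lemma sum_inverse_sqrt_le: "(\<Sum>e = 1..n. 1 / sqrt (real e)) \<le> 2 * sqrt (real n)"
proof (induction n)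
  case (Suc n)
  let ?a = "sqrt (real n)" and ?b = "sqrt (real (Suc n))"
  have b: "?b > 0" "?a \<le> ?b" by simp_all
  have "?b * ?b - ?a * ?a = 1" by simp
  hence "(?b - ?a) * (?b + ?a) = 1" by (simp add: algebra_simps)
  moreover have "(?b - ?a) * (?b + ?a) \<le> (?b - ?a) * (2 * ?b)"
    using b by (intro mult_left_mono) auto
  ultimately have "1 \<le> (2 * ?b - 2 * ?a) * ?b" by (simp add: algebra_simps)
  hence "1 / ?b \<le> 2 * ?b - 2 * ?a" using b by (subst pos_divide_le_eq) auto
  with Suc.IH show ?case by simp
qed simp

text \<open>For a given $e \<ge> 1$ there are at most $2 \<surd>(R / e)$ nonzero integers $\<pm> e y^2$ of size at most $R$, and
  the sum of $1 / \<surd>e$ over $e \<le> Z$ is at most $2 \<surd>Z$.\<close>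

lemma card_small_cofactor_of_square_le:
  fixes R Z :: real
  assumes R: "R \<ge> 0" and Z: "Z \<ge> 0"
  defines "S \<equiv> {X::int. X \<noteq> 0 \<and> real_of_int \<bar>X\<bar> \<le> R \<and> (\<exists>e y. X = e * y\<^sup>2 \<and> real_of_int \<bar>e\<bar> \<le> Z)}"
  shows "finite S" "real (card S) \<le> 4 * (sqrt R * sqrt Z)"
proof -
  define n where "n = nat \<lfloor>Z\<rfloor>"
  define N where "N e = nat \<lfloor>sqrt (R / real e)\<rfloor>" for e :: nat
  let ?I = "{1, -1::int} \<times> (SIGMA e:{1..n}. {1..N e})"
  let ?g = "\<lambda>(\<sigma>, e, y). \<sigma> * (int e * (int y)\<^sup>2)"
  have sub: "S \<subseteq> ?g ` ?I"
  proof
    fix X assume "X \<in> S"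
    then obtain e y where X: "X \<noteq> 0" "real_of_int \<bar>X\<bar> \<le> R" "X = e * y\<^sup>2" "real_of_int \<bar>e\<bar> \<le> Z"
      unfolding S_def by blast
    have e0: "e \<noteq> 0" "y \<noteq> 0" using X by auto
    define e' where "e' = nat \<bar>e\<bar>"
    define y' where "y' = nat \<bar>y\<bar>"
    have re: "real e' = real_of_int \<bar>e\<bar>" "real y' = real_of_int \<bar>y\<bar>" by (simp_all add: e'_def y'_def)
    have "e' \<in> {1..n}" using e0 X(4) by (auto simp: e'_def n_def nat_mono le_floor_iff)
    moreover have "y' \<in> {1..N e'}"
    proof -
      have "real e' * (real y')\<^sup>2 = real_of_int \<bar>X\<bar>" unfolding re X(3) by (simp add: abs_mult)
      hence "(real y')\<^sup>2 \<le> R / real e'" using X(2) e0 by (simp add: re field_simps)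
      hence "real y' \<le> sqrt (R / real e')" by (rule real_le_rsqrt)
      thus ?thesis using e0 by (auto simp: N_def y'_def le_nat_floor)
    qed
    moreover have "X = sgn e * (int e' * (int y')\<^sup>2)"
      using X(3) by (simp add: e'_def y'_def mult.assoc[symmetric] sgn_mult_abs)
    moreover have "sgn e \<in> {1, -1}" using e0 by (auto simp: sgn_if)
    ultimately show "X \<in> ?g ` ?I" by (intro image_eqI[of _ _ "(sgn e, e', y')"]) auto
  qed
  have fin: "finite ?I" by auto
  show "finite S" using finite_subset[OF sub] fin by blast
  have "card S \<le> card ?I" using surj_card_le[OF fin sub] .
  also have "\<dots> = 2 * (\<Sum>e = 1..n. N e)" by (simp add: card_cartesian_product)
  finally have "real (card S) \<le> 2 * (\<Sum>e = 1..n. real (N e))" by (simp flip: of_nat_sum)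
  also have "(\<Sum>e = 1..n. real (N e)) \<le> (\<Sum>e = 1..n. sqrt R * (1 / sqrt (real e)))"
  proof (rule sum_mono)
    fix e assume "e \<in> {1..n}"
    have "real (N e) \<le> sqrt (R / real e)" using R unfolding N_def by simp
    thus "real (N e) \<le> sqrt R * (1 / sqrt (real e))" by (simp add: real_sqrt_divide)
  qed
  also have "\<dots> = sqrt R * (\<Sum>e = 1..n. 1 / sqrt (real e))" by (simp only: sum_distrib_left)
  also have "\<dots> \<le> sqrt R * (2 * sqrt (real n))"
    using R by (intro mult_left_mono sum_inverse_sqrt_le) auto
  also have "\<dots> \<le> sqrt R * (2 * sqrt Z)" using R Z by (intro mult_left_mono) (auto simp: n_def)
  finally show "real (card S) \<le> 4 * (sqrt R * sqrt Z)" by simp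
qed

text \<open>Completing the square turns $A X^2 + B X + C = e y^2$ into $u^2 - 4 A e y^2 = B^2 - 4 A C$ with
  $u = 2 A X + B$. This is a Pell equation whose right-hand side is independent of $e$, so every $e$ contributes
  only logarithmically many $X$, with a uniform constant.\<close>

lemma card_small_cofactor_quadratic_le:
  fixes A B C :: int and \<epsilon> :: real
  assumes A: "A \<noteq> 0" and disc: "B\<^sup>2 - 4 * A * C \<noteq> 0" and \<epsilon>: "\<epsilon> > 0"
  obtains c :: real where "c \<ge> 0"
    "\<And>R E :: real. \<lbrakk>R \<ge> 1; E \<ge> 0\<rbrakk> \<Longrightarrow>
      finite {X. real_of_int \<bar>X\<bar> \<le> R \<and>
        (\<exists>e y. e \<noteq> 0 \<and> y \<noteq> 0 \<and> real_of_int \<bar>e\<bar> \<le> E \<and> A * X\<^sup>2 + B * X + C = e * y\<^sup>2)} \<and>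
      real (card {X. real_of_int \<bar>X\<bar> \<le> R \<and>
        (\<exists>e y. e \<noteq> 0 \<and> y \<noteq> 0 \<and> real_of_int \<bar>e\<bar> \<le> E \<and> A * X\<^sup>2 + B * X + C = e * y\<^sup>2)})
      \<le> c * (E * R powr \<epsilon>)"
proof -
  define k where "k = B\<^sup>2 - 4 * A * C"
  obtain c0 :: real where c0: "c0 \<ge> 0" and pell: "\<And>(m::int) (U::real). \<lbrakk>m \<noteq> 0; U \<ge> 1\<rbrakk> \<Longrightarrow>
       finite {u. real_of_int \<bar>u\<bar> \<le> U \<and> (\<exists>y. y \<noteq> 0 \<and> u\<^sup>2 - m * y\<^sup>2 = k)} \<and>
       real (card {u. real_of_int \<bar>u\<bar> \<le> U \<and> (\<exists>y. y \<noteq> 0 \<and> u\<^sup>2 - m * y\<^sup>2 = k)}) \<le> c0 * (log 2 U + 1)"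
    using card_pell_solutions_le[of k] disc unfolding k_def by blast
  define b where "b = real_of_int (2 * \<bar>A\<bar> + \<bar>B\<bar>)"
  have b: "b \<ge> 1" using A by (simp add: b_def)
  define l where "l = b powr \<epsilon> / (\<epsilon> * ln 2) + 1"
  have l: "l \<ge> 0" using \<epsilon> by (simp add: l_def)
  show ?thesis
  proof (rule that[of "2 * (c0 * l)"])
    show "2 * (c0 * l) \<ge> 0" using c0 l by simp
    fix R E :: real assume R: "R \<ge> 1" and E: "E \<ge> 0"
    define U where "U = b * R"
    have U: "U \<ge> 1" using b R mult_mono[of 1 b 1 R] by (simp add: U_def)
    have logU: "log 2 U + 1 \<le> l * R powr \<epsilon>"
    proof -
      have "ln U \<le> U powr \<epsilon> / \<epsilon>" by (rule ln_powr_bound[OF U \<epsilon>])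
      hence "log 2 U \<le> U powr \<epsilon> / \<epsilon> / ln 2" unfolding log_def by (intro divide_right_mono) auto
      also have "\<dots> = b powr \<epsilon> / (\<epsilon> * ln 2) * R powr \<epsilon>"
        using b R by (simp add: U_def powr_mult)
      finally have "log 2 U \<le> b powr \<epsilon> / (\<epsilon> * ln 2) * R powr \<epsilon>" .
      moreover have "1 \<le> R powr \<epsilon>" using R \<epsilon> by (intro ge_one_powr_ge_zero) auto
      ultimately show ?thesis by (simp add: l_def algebra_simps)
    qed
    define S where "S e = {X. real_of_int \<bar>X\<bar> \<le> R \<and> (\<exists>y. y \<noteq> 0 \<and> A * X\<^sup>2 + B * X + C = e * y\<^sup>2)}" for e
    let ?S = "{X. real_of_int \<bar>X\<bar> \<le> R \<and>
        (\<exists>e y. e \<noteq> 0 \<and> y \<noteq> 0 \<and> real_of_int \<bar>e\<bar> \<le> E \<and> A * X\<^sup>2 + B * X + C = e * y\<^sup>2)}"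
    let ?I = "{-\<lfloor>E\<rfloor>..\<lfloor>E\<rfloor>} - {0}"
    have cardI: "real (card ?I) \<le> 2 * E"
    proof -
      have "card ?I = nat (2 * \<lfloor>E\<rfloor>)" using E by simp
      thus ?thesis using E by simp
    qed
    have one: "finite (S e) \<and> real (card (S e)) \<le> c0 * (l * R powr \<epsilon>)" if e: "e \<noteq> 0" for e
    proof -
      let ?P = "{u. real_of_int \<bar>u\<bar> \<le> U \<and> (\<exists>y. y \<noteq> 0 \<and> u\<^sup>2 - (4 * A * e) * y\<^sup>2 = k)}"
      let ?h = "\<lambda>X. 2 * A * X + B"
      have P: "finite ?P" "real (card ?P) \<le> c0 * (log 2 U + 1)"
        using pell[of "4 * A * e" U] A e U by auto
      have inj: "inj_on ?h (S e)" using A by (auto intro!: inj_onI)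
      have sub: "?h ` S e \<subseteq> ?P"
      proof
        fix u assume "u \<in> ?h ` S e"
        then obtain X y where u: "u = ?h X" and X: "real_of_int \<bar>X\<bar> \<le> R"
          and y: "y \<noteq> 0" "A * X\<^sup>2 + B * X + C = e * y\<^sup>2" by (auto simp: S_def)
        have "u\<^sup>2 = 4 * A * (A * X\<^sup>2 + B * X + C) + k"
          unfolding u k_def by (simp add: power2_eq_square algebra_simps)
        hence "u\<^sup>2 - (4 * A * e) * y\<^sup>2 = k" unfolding y(2) by (simp add: algebra_simps)
        moreover have "real_of_int \<bar>u\<bar> \<le> U"
        proof -
          have "\<bar>u\<bar> \<le> 2 * \<bar>A\<bar> * \<bar>X\<bar> + \<bar>B\<bar>"
            unfolding u using abs_triangle_ineq[of "2 * A * X" B] by (simp add: abs_mult)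
          hence "real_of_int \<bar>u\<bar> \<le> real_of_int (2 * \<bar>A\<bar> * \<bar>X\<bar> + \<bar>B\<bar>)" by (simp only: of_int_le_iff)
          also have "\<dots> = 2 * real_of_int \<bar>A\<bar> * real_of_int \<bar>X\<bar> + real_of_int \<bar>B\<bar> * 1" by simp
          also have "\<dots> \<le> 2 * real_of_int \<bar>A\<bar> * R + real_of_int \<bar>B\<bar> * R"
            using X R by (intro add_mono mult_left_mono) auto
          also have "\<dots> = U" by (simp add: U_def b_def algebra_simps)
          finally show ?thesis .
        qed
        ultimately show "u \<in> ?P" using y(1) by blast
      qed
      have "finite (S e)" using finite_subset[OF sub P(1)] inj by (simp add: finite_image_iff)
      moreover have "card (S e) \<le> card ?P" using card_inj_on_le[OF inj sub P(1)] .
      moreover have "c0 * (log 2 U + 1) \<le> c0 * (l * R powr \<epsilon>)" using logU c0 by (intro mult_left_mono)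
      ultimately show ?thesis using P(2) by linarith
    qed
    have sub: "?S \<subseteq> (\<Union>e\<in>?I. S e)"
    proof
      fix X assume "X \<in> ?S"
      then obtain e y where *: "real_of_int \<bar>X\<bar> \<le> R" "e \<noteq> 0" "y \<noteq> 0" "real_of_int \<bar>e\<bar> \<le> E"
        "A * X\<^sup>2 + B * X + C = e * y\<^sup>2" by blast
      have "\<bar>e\<bar> \<le> \<lfloor>E\<rfloor>" using *(4) by (simp only: le_floor_iff)
      hence "e \<in> ?I" using *(2) by auto
      thus "X \<in> (\<Union>e\<in>?I. S e)" using * by (auto simp: S_def)
    qed
    have fin: "finite (\<Union>e\<in>?I. S e)" using one by auto
    have "card ?S \<le> card (\<Union>e\<in>?I. S e)" by (rule card_mono[OF fin sub])
    also have "\<dots> \<le> (\<Sum>e\<in>?I. card (S e))" by (rule card_UN_le) simp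
    finally have "real (card ?S) \<le> (\<Sum>e\<in>?I. real (card (S e)))" by (simp only: of_nat_sum[symmetric] of_nat_le_iff)
    also have "\<dots> \<le> (\<Sum>e\<in>?I. c0 * (l * R powr \<epsilon>))" using one by (intro sum_mono) auto
    also have "\<dots> = real (card ?I) * (c0 * (l * R powr \<epsilon>))" by (simp only: sum_constant)
    also have "\<dots> \<le> 2 * E * (c0 * (l * R powr \<epsilon>))" by (rule mult_right_mono[OF cardI]) (use c0 l in simp)
    finally show "finite ?S \<and> real (card ?S) \<le> 2 * (c0 * l) * (E * R powr \<epsilon>)"
      using finite_subset[OF sub fin] by (simp add: mult_ac)
  qed
qed

section \<open>Counting twists\<close>

text \<open>Send a twist to the abscissa $X$ of one of its points, and let $e_1$ and $e_2$ be the squarefree parts of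
  $X$ and of $H(X) = A X^2 + B X + C$. A common divisor of the two divides $C$, whence
  $|e_1 e_2| \<le> C^2 |d| \<le> C^2 D$. Since $|X|$ is at most about $D$, there are about
  $\<surd>D \<cdot> \<surd>Z$ abscissae with $|e_1| \<le> Z$, while $|e_1| > Z$ forces $|e_2| \<le> C^2 D / Z$ and leaves about
  $D / Z$ abscissae. The choice $Z = D^{1/3}$ makes the two counts equal.\<close>

lemma count_twists_le:
  fixes A B C :: int and \<epsilon> :: real
  assumes abc: "abc_conjecture"
    and nz: "A \<noteq> 0" "C \<noteq> 0" "B\<^sup>2 - 4 * A * C \<noteq> 0" and \<epsilon>: "0 < \<epsilon>" "\<epsilon> \<le> 1"
  obtains K :: real where "K > 0"
    "\<And>D::real. D \<ge> 1 \<Longrightarrow>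
       real (card {d. real_of_int \<bar>d\<bar> \<le> D \<and> squarefree d \<and>
         (\<exists>X Y. Y \<noteq> 0 \<and> d * Y\<^sup>2 = X * (A * X\<^sup>2 + B * X + C))}) \<le> K * D powr (2 / 3 + \<epsilon>)"
proof -
  obtain K0 :: real where K0: "K0 \<ge> 1" and height:
    "\<And>d X Y :: int. \<lbrakk>d \<noteq> 0; Y \<noteq> 0; d * Y\<^sup>2 = X * (A * X\<^sup>2 + B * X + C)\<rbrakk>
       \<Longrightarrow> real_of_int \<bar>X\<bar> \<le> K0 * real_of_int \<bar>d\<bar> powr (1 + \<epsilon>)"
    using abc_height_bound[OF abc nz \<epsilon>(1)] by blast
  define a where "a = \<epsilon> / 2"
  have a: "a > 0" using \<epsilon> by (simp add: a_def)
  obtain c :: real where c: "c \<ge> 0" and quad: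
    "\<And>R E :: real. \<lbrakk>R \<ge> 1; E \<ge> 0\<rbrakk> \<Longrightarrow>
      finite {X. real_of_int \<bar>X\<bar> \<le> R \<and>
        (\<exists>e y. e \<noteq> 0 \<and> y \<noteq> 0 \<and> real_of_int \<bar>e\<bar> \<le> E \<and> A * X\<^sup>2 + B * X + C = e * y\<^sup>2)} \<and>
      real (card {X. real_of_int \<bar>X\<bar> \<le> R \<and>
        (\<exists>e y. e \<noteq> 0 \<and> y \<noteq> 0 \<and> real_of_int \<bar>e\<bar> \<le> E \<and> A * X\<^sup>2 + B * X + C = e * y\<^sup>2)})
      \<le> c * (E * R powr a)"
    using card_small_cofactor_quadratic_le[OF nz(1,3) a] by blast
  define K where "K = 4 * sqrt K0 + c * real_of_int (C\<^sup>2) * K0 powr a"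
  show ?thesis
  proof (rule that[of K])
    show "K > 0" using K0 c unfolding K_def by (intro add_pos_nonneg mult_nonneg_nonneg) auto
    fix D :: real assume D: "D \<ge> 1"
    define R where "R = K0 * D powr (1 + \<epsilon>)"
    define Z where "Z = D powr (1 / 3)"
    define E where "E = real_of_int (C\<^sup>2) * D powr (2 / 3)"
    have "D powr (1 + \<epsilon>) \<ge> 1" using D \<epsilon> by (intro ge_one_powr_ge_zero) auto
    hence R: "R \<ge> 1" using K0 mult_mono[of 1 K0 1 "D powr (1 + \<epsilon>)"] by (simp add: R_def)
    have Z: "Z > 0" using D by (simp add: Z_def)
    have E: "E \<ge> 0" by (simp add: E_def)
    have EZ: "real_of_int (C\<^sup>2) * D = E * Z"
      using D by (simp add: E_def Z_def powr_add[symmetric])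
    define S1 where "S1 = {X::int. X \<noteq> 0 \<and> real_of_int \<bar>X\<bar> \<le> R \<and> (\<exists>e y. X = e * y\<^sup>2 \<and> real_of_int \<bar>e\<bar> \<le> Z)}"
    define S2 where "S2 = {X. real_of_int \<bar>X\<bar> \<le> R \<and>
        (\<exists>e y. e \<noteq> 0 \<and> y \<noteq> 0 \<and> real_of_int \<bar>e\<bar> \<le> E \<and> A * X\<^sup>2 + B * X + C = e * y\<^sup>2)}"
    have S1: "finite S1" "real (card S1) \<le> 4 * (sqrt R * sqrt Z)"
      unfolding S1_def using card_small_cofactor_of_square_le[of R Z] R Z by auto
    have S2: "finite S2" "real (card S2) \<le> c * (E * R powr a)"
      unfolding S2_def using quad[OF R E] by auto
    let ?T = "{d. real_of_int \<bar>d\<bar> \<le> D \<and> squarefree d \<and>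
         (\<exists>X Y. Y \<noteq> 0 \<and> d * Y\<^sup>2 = X * (A * X\<^sup>2 + B * X + C))}"
    define xx where "xx d = (SOME X. \<exists>Y. Y \<noteq> 0 \<and> d * Y\<^sup>2 = X * (A * X\<^sup>2 + B * X + C))" for d
    have xx: "\<exists>Y. Y \<noteq> 0 \<and> d * Y\<^sup>2 = xx d * (A * (xx d)\<^sup>2 + B * xx d + C)" if "d \<in> ?T" for d
      unfolding xx_def by (rule someI_ex) (use that in blast)
    have inj: "inj_on xx ?T"
    proof (rule inj_onI)
      fix d d' assume d: "d \<in> ?T" "d' \<in> ?T" "xx d = xx d'"
      obtain Y where Y: "Y \<noteq> 0" "d * Y\<^sup>2 = xx d * (A * (xx d)\<^sup>2 + B * xx d + C)"
        using xx[OF d(1)] by blast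
      obtain Y' where Y': "Y' \<noteq> 0" "d' * Y'\<^sup>2 = xx d' * (A * (xx d')\<^sup>2 + B * xx d' + C)"
        using xx[OF d(2)] by blast
      have "d * Y\<^sup>2 = d' * Y'\<^sup>2" using Y(2) Y'(2) d(3) by simp
      thus "d = d'" using squarefree_unique[of d d' Y Y'] d Y(1) Y'(1) by blast
    qed
    have sub: "xx ` ?T \<subseteq> S1 \<union> S2"
    proof
      fix X assume "X \<in> xx ` ?T"
      then obtain d where d: "d \<in> ?T" "X = xx d" by blast
      then obtain Y where Y: "Y \<noteq> 0" "d * Y\<^sup>2 = X * (A * X\<^sup>2 + B * X + C)" using xx by blast
      have dD: "real_of_int \<bar>d\<bar> \<le> D" and sf: "squarefree d" using d by auto
      have d0: "d \<noteq> 0" using sf by auto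
      define H where "H = A * X\<^sup>2 + B * X + C"
      have "d * Y\<^sup>2 = X * H" using Y(2) by (simp only: H_def)
      moreover have "d * Y\<^sup>2 \<noteq> 0" using d0 Y(1) by simp
      ultimately have XH: "X \<noteq> 0" "H \<noteq> 0" by auto
      have "real_of_int \<bar>X\<bar> \<le> K0 * real_of_int \<bar>d\<bar> powr (1 + \<epsilon>)" by (rule height[OF d0 Y])
      also have "\<dots> \<le> R" unfolding R_def using dD K0 \<epsilon> by (intro mult_left_mono powr_mono2) auto
      finally have XR: "real_of_int \<bar>X\<bar> \<le> R" .
      define e1 where "e1 = squarefree_part X"
      define e2 where "e2 = squarefree_part H"
      have X: "X = e1 * (square_part X)\<^sup>2" unfolding e1_def by (rule squarefree_decompose)
      have H: "H = e2 * (square_part H)\<^sup>2" unfolding e2_def by (rule squarefree_decompose)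
      have prod: "\<bar>e1 * e2\<bar> = (gcd e1 e2)\<^sup>2 * \<bar>d\<bar>"
      proof (rule squarefree_parts_product[OF sf])
        show "squarefree e1" "squarefree e2" by (auto simp: e1_def e2_def)
        show "d * Y\<^sup>2 = e1 * (square_part X)\<^sup>2 * (e2 * (square_part H)\<^sup>2)"
          using Y(2) X H unfolding H_def by metis
      qed (fact Y)
      show "X \<in> S1 \<union> S2"
      proof (cases "real_of_int \<bar>e1\<bar> \<le> Z")
        case True
        thus ?thesis using XH XR X unfolding S1_def by blast
      next
        case False
        have "gcd e1 e2 dvd C"
        proof -
          have "gcd e1 e2 dvd X" "gcd e1 e2 dvd H"
            by (metis X dvd_mult2 gcd_dvd1, metis H dvd_mult2 gcd_dvd2)
          moreover have "C = H - X * (A * X + B)" by (simp add: H_def power2_eq_square algebra_simps)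
          ultimately show ?thesis by (metis dvd_diff dvd_mult2)
        qed
        hence "gcd e1 e2 \<le> \<bar>C\<bar>" using dvd_imp_le_int[OF nz(2), of "gcd e1 e2"] by simp
        hence "(gcd e1 e2)\<^sup>2 \<le> \<bar>C\<bar>\<^sup>2" by (intro power_mono) auto
        hence "\<bar>e1 * e2\<bar> \<le> C\<^sup>2 * \<bar>d\<bar>" unfolding prod by (intro mult_right_mono) auto
        hence "real_of_int \<bar>e1 * e2\<bar> \<le> real_of_int (C\<^sup>2 * \<bar>d\<bar>)" by (simp only: of_int_le_iff)
        hence "real_of_int \<bar>e1\<bar> * real_of_int \<bar>e2\<bar> \<le> real_of_int (C\<^sup>2) * real_of_int \<bar>d\<bar>"
          by (simp only: abs_mult of_int_mult)
        also have "\<dots> \<le> real_of_int (C\<^sup>2) * D" using dD by (intro mult_left_mono) auto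
        finally have 1: "real_of_int \<bar>e1\<bar> * real_of_int \<bar>e2\<bar> \<le> E * Z" unfolding EZ .
        have "Z * real_of_int \<bar>e2\<bar> \<le> real_of_int \<bar>e1\<bar> * real_of_int \<bar>e2\<bar>"
          using False by (intro mult_right_mono) auto
        hence "Z * real_of_int \<bar>e2\<bar> \<le> Z * E" using 1 by (simp only: mult.commute)
        hence "real_of_int \<bar>e2\<bar> \<le> E" using Z by (simp only: mult_le_cancel_left_pos)
        moreover have "e2 \<noteq> 0" "square_part H \<noteq> 0" using XH by (auto simp: e2_def)
        ultimately show ?thesis using XR H unfolding S2_def H_def by blast
      qed
    qed
    have "card ?T = card (xx ` ?T)" using inj by (simp add: card_image)
    also have "\<dots> \<le> card (S1 \<union> S2)" using sub S1 S2 by (intro card_mono) auto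
    also have "\<dots> \<le> card S1 + card S2" by (rule card_Un_le)
    finally have "real (card ?T) \<le> 4 * (sqrt R * sqrt Z) + c * (E * R powr a)"
      using S1(2) S2(2) by linarith
    also have "sqrt R * sqrt Z = sqrt K0 * D powr (2 / 3 + a)"
    proof -
      have "sqrt R * sqrt Z = sqrt K0 * (D powr (1 + \<epsilon>) * D powr (1 / 3)) powr (1 / 2)"
        using K0 D by (simp add: R_def Z_def real_sqrt_mult powr_half_sqrt powr_mult)
      also have "(D powr (1 + \<epsilon>) * D powr (1 / 3)) powr (1 / 2) = D powr (2 / 3 + a)"
        by (simp add: powr_add[symmetric] powr_powr a_def algebra_simps add_divide_distrib)
      finally show ?thesis .
    qed
    also have "E * R powr a = real_of_int (C\<^sup>2) * K0 powr a * D powr (2 / 3 + (1 + \<epsilon>) * a)"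
      using K0 D by (simp add: E_def R_def powr_mult powr_powr powr_add algebra_simps)
    also have "4 * (sqrt K0 * D powr (2 / 3 + a)) + c * (real_of_int (C\<^sup>2) * K0 powr a * D powr (2 / 3 + (1 + \<epsilon>) * a))
        \<le> 4 * (sqrt K0 * D powr (2 / 3 + \<epsilon>)) + c * (real_of_int (C\<^sup>2) * K0 powr a * D powr (2 / 3 + \<epsilon>))"
    proof -
      have "(1 + \<epsilon>) * a \<le> 2 * a" using \<epsilon> a by (intro mult_right_mono) auto
      thus ?thesis using D K0 c \<epsilon> by (intro add_mono mult_left_mono powr_mono) (auto simp: a_def)
    qed
    also have "\<dots> = K * D powr (2 / 3 + \<epsilon>)" by (simp add: K_def algebra_simps)
    finally show "real (card ?T) \<le> K * D powr (2 / 3 + \<epsilon>)" .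
  qed
qed

text \<open>A reducible cubic has a rational root $n / a$. In the variable $X = a x - n$ the polynomial $a^3 f$
  has integer coefficients and the root $0$. One further factor $a$ turns $a^3 d y^2$ into $d$ times a square.
  Separability of $f$ enters twice: $C = 0$ would make $n / a$ a double root, and a vanishing
  discriminant would make the root of the quadratic factor a double root.\<close>

lemma cubic_normal_form:
  fixes f :: "int poly"
  assumes ell: "elliptic_cubic f" and red: "reducible_over_rat f"
  obtains a n A B C :: int where "a \<noteq> 0" "A \<noteq> 0" "C \<noteq> 0" "B\<^sup>2 - 4 * A * C \<noteq> 0"
    "\<And>x. a ^ 4 * poly f x = (a * x - n) * (A * (a * x - n)\<^sup>2 + B * (a * x - n) + C)"
proof -
  have deg: "degree f = 3" and cop: "coprime (rat_poly_of f) (pderiv (rat_poly_of f))"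
    using ell by (auto simp: elliptic_cubic_def)
  define c0 c1 c2 c3 where "c0 = coeff f 0" and "c1 = coeff f 1" and "c2 = coeff f 2" and "c3 = coeff f 3"
  have c3: "c3 \<noteq> 0" using deg unfolding c3_def by (metis leading_coeff_0_iff degree_0 zero_neq_numeral)
  have f: "f = [:c0, c1, c2, c3:]"
  proof (rule poly_eqI)
    fix i show "coeff f i = coeff [:c0, c1, c2, c3:] i"
    proof (cases "i \<le> 3")
      case True
      hence "i = 0 \<or> i = 1 \<or> i = 2 \<or> i = 3" by auto
      thus ?thesis by (auto simp: c0_def c1_def c2_def c3_def numeral_eq_Suc)
    next
      case False
      thus ?thesis using deg by (simp add: coeff_eq_0 coeff_pCons split: nat.splits)
    qed
  qed
  define q where "q = rat_poly_of f"
  have q: "q = [:of_int c0, of_int c1, of_int c2, of_int c3:]"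
    unfolding q_def rat_poly_of_def f by (simp add: map_poly_pCons)
  have q0: "q \<noteq> 0" "degree q = 3" using c3 unfolding q by simp_all
  have no_double: "\<not> (poly q r = 0 \<and> poly (pderiv q) r = 0)" for r
  proof
    assume "poly q r = 0 \<and> poly (pderiv q) r = 0"
    hence "[:-r, 1:] dvd q" "[:-r, 1:] dvd pderiv q" by (simp_all add: poly_eq_0_iff_dvd)
    hence "is_unit [:-r, 1:]" using cop unfolding q_def by (rule coprime_common_divisor[rotated])
    thus False by (simp add: is_unit_pCons_iff)
  qed
  obtain r where r: "poly q r = 0"
  proof -
    have "\<not> is_unit q" using q0 by (simp add: is_unit_iff_degree)
    then obtain g h where gh: "q = g * h" "\<not> is_unit g" "\<not> is_unit h"
      using red q0 unfolding reducible_over_rat_def q_def irreducible_def by blast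
    have nz: "g \<noteq> 0" "h \<noteq> 0" using gh q0 by auto
    have "degree g + degree h = 3" using q0(2) gh nz by (simp add: degree_mult_eq)
    moreover have "degree g \<noteq> 0" "degree h \<noteq> 0" using gh nz by (simp_all add: is_unit_iff_degree)
    ultimately have "degree g = 1 \<or> degree h = 1" by linarith
    moreover have "\<exists>r. poly p r = 0" if lin: "degree p = 1" for p :: "rat poly"
    proof -
      obtain u v where "p = [:u, v:]" "v \<noteq> 0"
        using degree1_coeffs[OF lin] by metis
      hence "poly p (- u / v) = 0" by simp
      thus ?thesis by blast
    qed
    ultimately obtain r where "poly g r = 0 \<or> poly h r = 0" by blast
    thus ?thesis using that[of r] gh by auto
  qed
  obtain n a where ra: "r = of_int n / of_int a" and a0: "a \<noteq> (0::int)"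
    by (cases r) (auto simp: Fract_of_int_quotient)
  define A where "A = c3"
  define B where "B = 3 * c3 * n + c2 * a"
  define C where "C = 3 * c3 * n\<^sup>2 + 2 * c2 * a * n + c1 * a\<^sup>2"
  have root: "c0 * a ^ 3 + c1 * n * a\<^sup>2 + c2 * n\<^sup>2 * a + c3 * n ^ 3 = 0"
  proof -
    have "of_int (c0 * a ^ 3 + c1 * n * a\<^sup>2 + c2 * n\<^sup>2 * a + c3 * n ^ 3) = (of_int a) ^ 3 * poly q r"
      unfolding q ra using a0 by (simp add: field_simps power2_eq_square power3_eq_cube)
    thus ?thesis unfolding r by (simp only: mult_zero_right of_int_eq_0_iff)
  qed
  let ?a = "of_int a :: rat" and ?n = "of_int n :: rat"
  have val: "?a ^ 3 * poly q ((X + ?n) / ?a) = X * (of_int A * X\<^sup>2 + of_int B * X + of_int C)" for X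
  proof -
    have "?a ^ 3 * poly q ((X + ?n) / ?a) =
      of_int (c0 * a ^ 3 + c1 * n * a\<^sup>2 + c2 * n\<^sup>2 * a + c3 * n ^ 3) +
      X * (of_int A * X\<^sup>2 + of_int B * X + of_int C)"
      unfolding q A_def B_def C_def using a0
      by (simp add: field_simps power2_eq_square power3_eq_cube)
    thus ?thesis unfolding root by simp
  qed
  have der: "?a\<^sup>2 * poly (pderiv q) ((X + ?n) / ?a)
      = (of_int A * X\<^sup>2 + of_int B * X + of_int C) + X * (2 * of_int A * X + of_int B)" for X
    unfolding q A_def B_def C_def using a0
    by (simp add: pderiv_pCons field_simps power2_eq_square power3_eq_cube)
  have A0: "A \<noteq> 0" using c3 by (simp add: A_def)
  have C0: "C \<noteq> 0"
  proof
    assume "C = 0"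
    with der[of 0] have "poly (pderiv q) r = 0" using a0 by (simp add: ra)
    with r no_double show False by blast
  qed
  have disc: "B\<^sup>2 - 4 * A * C \<noteq> 0"
  proof
    assume D: "B\<^sup>2 - 4 * A * C = 0"
    define X :: rat where "X = - of_int B / (2 * of_int A)"
    have X: "2 * of_int A * X + of_int B = 0" using A0 by (simp add: X_def)
    have "4 * of_int A * (of_int A * X\<^sup>2 + of_int B * X + of_int C)
        = (2 * of_int A * X + of_int B)\<^sup>2 - of_int (B\<^sup>2 - 4 * A * C)"
      by (simp add: power2_eq_square algebra_simps)
    hence "of_int A * X\<^sup>2 + of_int B * X + of_int C = 0" unfolding X D using A0 by simp
    hence "poly q ((X + ?n) / ?a) = 0 \<and> poly (pderiv q) ((X + ?n) / ?a) = 0"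
      using val[of X] der[of X] X a0 by simp
    thus False using no_double by blast
  qed
  show ?thesis
  proof (rule that[of a "a * A" "a * C" "a * B" n])
    show "a \<noteq> 0" "a * A \<noteq> 0" "a * C \<noteq> 0" using a0 A0 C0 by auto
    have "(a * B)\<^sup>2 - 4 * (a * A) * (a * C) = a\<^sup>2 * (B\<^sup>2 - 4 * A * C)"
      by (simp add: power2_eq_square algebra_simps)
    thus "(a * B)\<^sup>2 - 4 * (a * A) * (a * C) \<noteq> 0" using a0 disc by simp
    fix x :: int
    have "(a * x - n) * ((a * A) * (a * x - n)\<^sup>2 + (a * B) * (a * x - n) + a * C)
        = a ^ 4 * poly f x - a * (c0 * a ^ 3 + c1 * n * a\<^sup>2 + c2 * n\<^sup>2 * a + c3 * n ^ 3)"
      unfolding f A_def B_def C_def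
      by (simp add: power2_eq_square power3_eq_cube power4_eq_xxxx algebra_simps)
    thus "a ^ 4 * poly f x = (a * x - n) * ((a * A) * (a * x - n)\<^sup>2 + (a * B) * (a * x - n) + a * C)"
      unfolding root by simp
  qed
qed

text \<open>The $o(1)$ is read off from the counting function itself, as the excess of $\log_D c(D)$ over $\<theta>$.
  The implied constants are absorbed by a second power $D^\<epsilon>$ for large $D$.\<close>

lemma exponent_from_epsilon_bounds:
  fixes c :: "real \<Rightarrow> real" and \<theta> :: real
  assumes nonneg: "\<And>D. c D \<ge> 0"
    and bound: "\<And>\<epsilon>. 0 < \<epsilon> \<Longrightarrow> \<epsilon> \<le> 1 \<Longrightarrow> \<exists>K>0. \<forall>D\<ge>1. c D \<le> K * D powr (\<theta> + \<epsilon>)"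
  shows "\<exists>e :: real \<Rightarrow> real. (e \<longlongrightarrow> 0) at_top \<and> (\<forall>\<^sub>F D in at_top. c D \<le> D powr (\<theta> + e D))"
proof -
  \<comment> \<open>For c D = 0 the logarithm carries no information, so the excess is set to 0.\<close>
  define e where "e D = (if c D = 0 then 0 else max 0 (log D (c D) - \<theta>))" for D
  have bd: "c D \<le> D powr (\<theta> + e D)" if D: "D > 1" for D
  proof (cases "c D = 0")
    case False
    hence pos: "c D > 0" using nonneg[of D] by simp
    have "c D = D powr (log D (c D))" using D pos by simp
    also have "\<dots> \<le> D powr (\<theta> + e D)" using D False by (intro powr_mono) (auto simp: e_def)
    finally show ?thesis .
  qed simp
  have ev: "\<forall>\<^sub>F D in at_top. c D \<le> D powr (\<theta> + e D)"
    by (rule eventually_mono[OF eventually_gt_at_top[of 1]]) (rule bd)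
  have "(e \<longlongrightarrow> 0) at_top"
  proof (rule tendstoI)
    fix \<eta> :: real assume \<eta>: "\<eta> > 0"
    define \<epsilon> where "\<epsilon> = min 1 (\<eta> / 3)"
    have \<epsilon>: "0 < \<epsilon>" "\<epsilon> \<le> 1" "2 * \<epsilon> < \<eta>" using \<eta> by (auto simp: \<epsilon>_def min_def)
    obtain K where K: "K > 0" "\<And>D. D \<ge> 1 \<Longrightarrow> c D \<le> K * D powr (\<theta> + \<epsilon>)"
      using bound[OF \<epsilon>(1,2)] by blast
    show "\<forall>\<^sub>F D in at_top. dist (e D) 0 < \<eta>"
      using eventually_gt_at_top[of "max 1 (K powr (1 / \<epsilon>))"]
    proof eventually_elim
      fix D assume "max 1 (K powr (1 / \<epsilon>)) < D"
      hence D: "D > 1" "K powr (1 / \<epsilon>) < D" by auto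
      have "e D \<le> 2 * \<epsilon>"
      proof (cases "c D = 0")
        case False
        hence pos: "c D > 0" using nonneg[of D] by simp
        have "K = (K powr (1 / \<epsilon>)) powr \<epsilon>" using K \<epsilon> by (simp add: powr_powr)
        also have "\<dots> \<le> D powr \<epsilon>" using D \<epsilon> by (intro powr_mono2) auto
        finally have KD: "K \<le> D powr \<epsilon>" .
        have "c D \<le> K * D powr (\<theta> + \<epsilon>)" using K(2)[of D] D by simp
        also have "\<dots> \<le> D powr \<epsilon> * D powr (\<theta> + \<epsilon>)" using KD by (intro mult_right_mono) auto
        also have "\<dots> = D powr (\<theta> + 2 * \<epsilon>)" by (simp add: powr_add[symmetric] algebra_simps)
        finally have "log D (c D) \<le> log D (D powr (\<theta> + 2 * \<epsilon>))"
          using D pos by (subst log_le_cancel_iff) auto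
        also have "\<dots> = \<theta> + 2 * \<epsilon>" using D by simp
        finally show ?thesis using False \<epsilon> by (simp add: e_def)
      qed (use \<epsilon> in \<open>simp add: e_def\<close>)
      moreover have "e D \<ge> 0" by (simp add: e_def)
      ultimately show "dist (e D) 0 < \<eta>" using \<epsilon> by (simp add: dist_real_def)
    qed
  qed
  with ev show ?thesis by blast
qed

theorem theoremB:
  fixes f :: "int poly"
  assumes "abc_conjecture"
    and "elliptic_cubic f"
    and "reducible_over_rat f"
  shows "\<exists>e :: real \<Rightarrow> real. (e \<longlongrightarrow> 0) at_top \<and>
           (\<forall>\<^sub>F D in at_top. real (card (T f D)) \<le> D powr (2 / 3 + e D))"
proof (rule exponent_from_epsilon_bounds[where c = "\<lambda>D. real (card (T f D))" and \<theta> = "2 / 3"])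
  fix \<epsilon> :: real assume \<epsilon>: "0 < \<epsilon>" "\<epsilon> \<le> 1"
  obtain a n A B C :: int where a: "a \<noteq> 0" and nz: "A \<noteq> 0" "C \<noteq> 0" "B\<^sup>2 - 4 * A * C \<noteq> 0"
    and eq: "\<And>x. a ^ 4 * poly f x = (a * x - n) * (A * (a * x - n)\<^sup>2 + B * (a * x - n) + C)"
    by (rule cubic_normal_form[OF assms(2,3)]) (rule that; assumption)
  let ?T = "\<lambda>D. {d. real_of_int \<bar>d\<bar> \<le> D \<and> squarefree d \<and>
         (\<exists>X Y. Y \<noteq> 0 \<and> d * Y\<^sup>2 = X * (A * X\<^sup>2 + B * X + C))}"
  obtain K :: real where K: "K > 0" "\<And>D. D \<ge> 1 \<Longrightarrow> real (card (?T D)) \<le> K * D powr (2 / 3 + \<epsilon>)"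
    using count_twists_le[OF assms(1) nz \<epsilon>] by blast
  have "real (card (T f D)) \<le> K * D powr (2 / 3 + \<epsilon>)" if D: "D \<ge> 1" for D
  proof -
    have "T f D \<subseteq> ?T D"
    proof
      fix d assume d: "d \<in> T f D"
      then obtain x y where xy: "d * y\<^sup>2 = poly f x" "y \<noteq> 0"
        by (auto simp: T_def nontrivial_integral_points_def)
      have "d * (a\<^sup>2 * y)\<^sup>2 = a ^ 4 * poly f x"
        unfolding xy(1)[symmetric] by (simp add: power_mult_distrib power_mult[symmetric])
      hence "d * (a\<^sup>2 * y)\<^sup>2 = (a * x - n) * (A * (a * x - n)\<^sup>2 + B * (a * x - n) + C)"
        unfolding eq .
      moreover have "a\<^sup>2 * y \<noteq> 0" using a xy by simp
      moreover have "real_of_int \<bar>d\<bar> \<le> D" "squarefree d" using d by (auto simp: T_def)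
      ultimately show "d \<in> ?T D" by blast
    qed
    moreover have "finite (?T D)"
    proof (rule finite_subset)
      show "?T D \<subseteq> {- \<lfloor>D\<rfloor>..\<lfloor>D\<rfloor>}" by (auto simp: le_floor_iff abs_le_iff minus_le_iff)
    qed simp
    ultimately have "card (T f D) \<le> card (?T D)" by (intro card_mono)
    thus ?thesis using K(2)[OF D] by linarith
  qed
  thus "\<exists>K>0. \<forall>D\<ge>1. real (card (T f D)) \<le> K * D powr (2 / 3 + \<epsilon>)" using K(1) by blast
qed simp

end
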